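(* Let $S$ be a compact metric space and let $q\in C(S\times S;(0,\infty))$. Let $\mu_{i,n},\mu_i\in\mathcal{P}(S)$ and $q_n\in C(S\times S;(0,\infty))$ for $i=1,2$, $n\ge 1$, and suppose that $$\lim_{n\to\infty}\bigl(\|\mu_{1,n}\mu_{2,n}-\mu_1\mu_2\|+\|q_n-q\|_\infty\bigr)=0.$$ Then $$\lim_{n\to\infty}\bigl\|\nu_1(\cdot;q_n,\mu_{1,n},\mu_{2,n})\,\nu_2(\cdot;q_n,\mu_{1,n},\mu_{2,n})-\nu_1(\cdot;q,\mu_1,\mu_2)\,\nu_2(\cdot;q,\mu_1,\mu_2)\bigr\|=0,$$ $$\lim_{n\to\infty}\sum_{i=1}^2\|u_i(\cdot;q_n,\mu_{1,n},\mu_{2,n})-u_i(\cdot;q,\mu_1,\mu_2)\|_\infty=0.$$ Moreover, for $i=1,2$ and any sequence $\{x_n\}_{n\ge1}\subset S$ converging to $x\in S$ as $n\to\infty$, $$\lim_{n\to\infty}u_i(x_n;q_n,\mu_{1,n},\mu_{2,n})=u_i(x;q,\mu_1,\mu_2).$$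
   Context: $\mathcal{P}(S)$ is the set of Borel probability measures on $S$. For measures $\mu_1,\mu_2$ on $S$, $\mu_1\mu_2$ denotes the product measure $\mu_1(dx_1)\mu_2(dx_2)$ on $S\times S$. For a finite signed Borel measure $\mu$ on a metric space $X$ (here $X=S$ or $S\times S$), $\|\mu\|:=\sup\{\int_X\phi\,d\mu : \phi\in C(X),\ \|\phi\|_\infty\le 1\}$, and $\|f\|_\infty:=\sup_{x\in X}|f(x)|$ for $f\in C(X)$. Schrödinger's functional equation: for $\mu_1,\mu_2\in\mathcal{P}(S)$ and positive $q\in C(S\times S)$, find nonnegative $\sigma$-finite Borel measures $\nu_1,\nu_2$ on $S$ such that $$\mu_1(dx_1)=\nu_1(dx_1)\int_S q(x_1,x_2)\nu_2(dx_2),\qquad \mu_2(dx_2)=\nu_2(dx_2)\int_S q(x_1,x_2)\nu_1(dx_1).$$ It is known that the product measure $\nu_1(dx_1)\nu_2(dx_2)$ solving this exists and is unique. Since $S$ is compact, the pair $(\nu_1,\nu_2)$ is made unique by the normalization $\nu_1(S)=\nu_2(S)$; this normalized pair is denoted $\nu_i(dx)=\nu_i(dx;q,\mu_1,\mu_2)$, $i=1,2$. Define, for $i,j\in\{1,2\}$, $i\ne j$, $$u_i(x_i)=u_i(x_i;q,\mu_1,\mu_2):=\log\Bigl(\int_S q(x_1,x_2)\,\nu_j(dx_j;q,\mu_1,\mu_2)\Bigr),\qquad x_i\in S.$$ *)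

theory Defs
  imports "HOL-Probability.Probability"
begin

definition borel_probs :: "'a::metric_space set \<Rightarrow> 'a measure set" where
  "borel_probs S = {\<mu>. sets \<mu> = sets (restrict_space borel S) \<and> prob_space \<mu>}"

definition sup_norm_on :: "'a set \<Rightarrow> ('a \<Rightarrow> real) \<Rightarrow> real" where
  "sup_norm_on X f = (SUP x\<in>X. \<bar>f x\<bar>)"

text \<open>
  The norm of the signed measure \<open>M - N\<close>, for finite measures \<open>M\<close> and \<open>N\<close> on \<open>X\<close>; the integral of a
  test function against the difference is the difference of the integrals.
  For a compact metric space \<open>S\<close>, the product \<open>\<sigma>\<close>-algebra on \<open>S \<times> S\<close> is the Borel
  \<open>\<sigma>\<close>-algebra of \<open>S \<times> S\<close>, so this applies with \<open>X = S \<times> S\<close> to product measures.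
\<close>

definition measure_diff_norm ::
    "'a::metric_space set \<Rightarrow> 'a measure \<Rightarrow> 'a measure \<Rightarrow> real" where
  "measure_diff_norm X M N =
     (SUP \<phi>\<in>{\<phi> :: 'a \<Rightarrow> real. continuous_on X \<phi> \<and> sup_norm_on X \<phi> \<le> 1}.
        (\<integral>x. \<phi> x \<partial>M) - (\<integral>x. \<phi> x \<partial>N))"

definition schroedinger_solution ::
    "'a::metric_space set \<Rightarrow> ('a \<times> 'a \<Rightarrow> real) \<Rightarrow> 'a measure \<Rightarrow> 'a measure
      \<Rightarrow> 'a measure \<Rightarrow> 'a measure \<Rightarrow> bool" where
  "schroedinger_solution S q \<mu>\<^sub>1 \<mu>\<^sub>2 \<nu>\<^sub>1 \<nu>\<^sub>2 \<longleftrightarrow>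
     sets \<nu>\<^sub>1 = sets (restrict_space borel S) \<and> sigma_finite_measure \<nu>\<^sub>1 \<and>
     sets \<nu>\<^sub>2 = sets (restrict_space borel S) \<and> sigma_finite_measure \<nu>\<^sub>2 \<and>
     \<mu>\<^sub>1 = density \<nu>\<^sub>1 (\<lambda>x\<^sub>1. \<integral>\<^sup>+x\<^sub>2. ennreal (q (x\<^sub>1, x\<^sub>2)) \<partial>\<nu>\<^sub>2) \<and>
     \<mu>\<^sub>2 = density \<nu>\<^sub>2 (\<lambda>x\<^sub>2. \<integral>\<^sup>+x\<^sub>1. ennreal (q (x\<^sub>1, x\<^sub>2)) \<partial>\<nu>\<^sub>1)"

text \<open>
  The pair of measures normalized by \<open>\<nu>\<^sub>1 S = \<nu>\<^sub>2 S\<close>. For compact \<open>S\<close>, continuous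
  positive \<open>q\<close> and Borel probability measures \<open>\<mu>\<^sub>1\<close>, \<open>\<mu>\<^sub>2\<close> it exists and is unique, and both
  members are finite measures.
\<close>

definition schroedinger_pair ::
    "'a::metric_space set \<Rightarrow> ('a \<times> 'a \<Rightarrow> real) \<Rightarrow> 'a measure \<Rightarrow> 'a measure
      \<Rightarrow> 'a measure \<times> 'a measure" where
  "schroedinger_pair S q \<mu>\<^sub>1 \<mu>\<^sub>2 =
     (THE p. schroedinger_solution S q \<mu>\<^sub>1 \<mu>\<^sub>2 (fst p) (snd p) \<and>
             emeasure (fst p) S = emeasure (snd p) S)"

definition schroedinger_nu1 ::
    "'a::metric_space set \<Rightarrow> ('a \<times> 'a \<Rightarrow> real) \<Rightarrow> 'a measure \<Rightarrow> 'a measure \<Rightarrow> 'a measure" where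
  "schroedinger_nu1 S q \<mu>\<^sub>1 \<mu>\<^sub>2 = fst (schroedinger_pair S q \<mu>\<^sub>1 \<mu>\<^sub>2)"

definition schroedinger_nu2 ::
    "'a::metric_space set \<Rightarrow> ('a \<times> 'a \<Rightarrow> real) \<Rightarrow> 'a measure \<Rightarrow> 'a measure \<Rightarrow> 'a measure" where
  "schroedinger_nu2 S q \<mu>\<^sub>1 \<mu>\<^sub>2 = snd (schroedinger_pair S q \<mu>\<^sub>1 \<mu>\<^sub>2)"

definition schroedinger_u1 ::
    "'a::metric_space set \<Rightarrow> ('a \<times> 'a \<Rightarrow> real) \<Rightarrow> 'a measure \<Rightarrow> 'a measure \<Rightarrow> 'a \<Rightarrow> real" where
  "schroedinger_u1 S q \<mu>\<^sub>1 \<mu>\<^sub>2 x\<^sub>1 = ln (\<integral>x\<^sub>2. q (x\<^sub>1, x\<^sub>2) \<partial>schroedinger_nu2 S q \<mu>\<^sub>1 \<mu>\<^sub>2)"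

definition schroedinger_u2 ::
    "'a::metric_space set \<Rightarrow> ('a \<times> 'a \<Rightarrow> real) \<Rightarrow> 'a measure \<Rightarrow> 'a measure \<Rightarrow> 'a \<Rightarrow> real" where
  "schroedinger_u2 S q \<mu>\<^sub>1 \<mu>\<^sub>2 x\<^sub>2 = ln (\<integral>x\<^sub>1. q (x\<^sub>1, x\<^sub>2) \<partial>schroedinger_nu1 S q \<mu>\<^sub>1 \<mu>\<^sub>2)"

end

theory Submission
  imports Defs
begin

text \<open>
  Write \<open>f = exp u\<^sub>1\<close> and \<open>g = exp u\<^sub>2\<close>. Schroedinger's equation says that \<open>\<nu>\<^sub>1 = \<mu>\<^sub>1 / f\<close>,
  \<open>\<nu>\<^sub>2 = \<mu>\<^sub>2 / g\<close>, \<open>f x = \<integral> q (x, y) / g y d\<mu>\<^sub>2\<close> and \<open>g y = \<integral> q (x, y) / f x d\<mu>\<^sub>1\<close>, so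
  \<open>f\<close> is a fixed point of a map that is positively homogeneous of degree one. If \<open>m \<le> q \<le> M\<close>, each of
  the two integral operators shrinks the oscillation \<open>r = max (f/f') / min (f/f')\<close> of the quotient of two positive functions:
  \<open>r - 1\<close> is multiplied by at most \<open>1 - (m/M)\<^sup>2\<close> (a form of Birkhoff's contraction theorem for
  Hilbert's projective metric). Iterating the map gives existence, and contraction gives uniqueness up
  to a factor, which the normalization fixes. The contraction rate is uniform for \<open>q\<^sub>n\<close> near \<open>q\<close>, so
  a fixed point of the perturbed map is projectively close to \<open>f\<close> as soon as the perturbed map
  nearly fixes \<open>f\<close>; the normalization again controls the factor. Only integrals of continuous
  functions against \<open>\<mu>\<^sub>i\<^sub>,\<^sub>n - \<mu>\<^sub>i\<close> enter, which the norm bounds directly.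
\<close>

subsection \<open>Continuous functions on a compact space and measurability\<close>

text \<open>The obstacle is scale. Replacing \<open>f\<close> by \<open>s * f\<close> and
  \<open>g\<close> by \<open>g / s\<close> preserves both integral equations, so fixed points come
  in rays and no metric on functions makes the map a contraction; only ratios can be compared, and
  each comparison loses a scalar. In the existence proof that scalar is an eigenvalue: the iteration
  yields \<open>h\<close> and \<open>k\<close> with \<open>h\<close> reproduced up to
  \<open>lam\<close>, and integrating \<open>q (x, y) / (h x * k y)\<close> against the product of
  two probability measures gives 1 in one order and \<open>lam\<close> in the other. In uniqueness
  and stability it is a factor \<open>s\<close>: the two total masses scale by \<open>1 / s\<close>
  and \<open>s\<close>, so their quotient determines the square of \<open>s\<close>. No rate of
  iteration is needed for stability. The best ratio constant between two positive functions is
  attained, so an inequality satisfied by every admissible constant can be solved for the best one.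
  If one step contracts by \<open>c\<close> and the perturbation costs a factor \<open>E\<close>,
  this yields \<open>c * E / (1 - (1 - c) * E)\<close>, which tends to 1 as \<open>E\<close>
  does.\<close>

definition pos_cont :: "'a::topological_space set \<Rightarrow> ('a \<Rightarrow> real) \<Rightarrow> bool" where
  "pos_cont X f \<longleftrightarrow> continuous_on X f \<and> (\<forall>x\<in>X. 0 < f x)"

lemma pos_cont_bounds:
  assumes "compact X" "pos_cont X f"
  obtains m M where "0 < m" "0 < M" "\<And>x. x \<in> X \<Longrightarrow> m \<le> f x \<and> f x \<le> M"
proof (cases "X = {}")
  case True
  then show ?thesis using that[of 1 1] by auto
next
  case False
  have c: "continuous_on X f" and p: "\<And>x. x \<in> X \<Longrightarrow> 0 < f x"
    using assms(2) by (auto simp: pos_cont_def)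
  obtain a where a: "a \<in> X" "\<And>x. x \<in> X \<Longrightarrow> f a \<le> f x"
    using continuous_attains_inf[OF assms(1) False c] by auto
  obtain b where b: "b \<in> X" "\<And>x. x \<in> X \<Longrightarrow> f x \<le> f b"
    using continuous_attains_sup[OF assms(1) False c] by auto
  show ?thesis using that[of "f a" "f b"] a b p by auto
qed

lemma pos_cont_section:
  assumes "pos_cont (S \<times> S) k" "x \<in> S"
  shows "pos_cont S (\<lambda>y. k (x, y))"
  using assms unfolding pos_cont_def
  by (auto intro!: continuous_on_compose2[of "S \<times> S" k] continuous_intros)

lemma pos_cont_swap:
  assumes "pos_cont (S \<times> S) k"
  shows "pos_cont (S \<times> S) (k \<circ> prod.swap)"
  using assms unfolding pos_cont_def comp_def
  by (auto intro!: continuous_on_compose2[of "S \<times> S" k] continuous_on_swap)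

lemma pos_cont_divide:
  assumes "pos_cont X f" "pos_cont X g"
  shows "pos_cont X (\<lambda>x. f x / g x)"
  using assms unfolding pos_cont_def by (force intro!: continuous_intros divide_pos_pos)

lemma borel_probsD:
  assumes "\<mu> \<in> borel_probs S"
  shows "prob_space \<mu>" "sets \<mu> = sets (restrict_space borel S)" "space \<mu> = S" "S \<noteq> {}"
proof -
  show 1: "prob_space \<mu>" and 2: "sets \<mu> = sets (restrict_space borel S)"
    using assms by (auto simp: borel_probs_def)
  show 3: "space \<mu> = S"
    using sets_eq_imp_space_eq[OF 2] by (simp add: space_restrict_space)
  show "S \<noteq> {}"
    using prob_space.not_empty[OF 1] 3 by simp
qed

lemma borel_measurable_cont_restrict:
  fixes f :: "'a::metric_space \<Rightarrow> real"
  assumes "sets \<mu> = sets (restrict_space borel S)" "continuous_on S f"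
  shows "f \<in> borel_measurable \<mu>"
  using borel_measurable_continuous_on_restrict[OF assms(2)] measurable_cong_sets[OF assms(1) refl]
  by blast

lemma integrable_cont_compact:
  fixes f :: "'a::metric_space \<Rightarrow> real"
  assumes "compact S" "finite_measure \<mu>" "sets \<mu> = sets (restrict_space borel S)" "continuous_on S f"
  shows "integrable \<mu> f"
proof -
  have sp: "space \<mu> = S"
    using sets_eq_imp_space_eq[OF assms(3)] by (simp add: space_restrict_space)
  have "bounded (f ` S)"
    using assms compact_continuous_image compact_imp_bounded by blast
  then obtain B where "\<And>x. x \<in> S \<Longrightarrow> \<bar>f x\<bar> \<le> B"
    by (auto simp: bounded_iff)
  then show ?thesis
    using borel_measurable_cont_restrict[OF assms(3,4)] sp
    by (intro finite_measure.integrable_const_bound[OF assms(2)]) (auto intro!: AE_I2)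
qed

text \<open>
  The type need not be second countable, so the Borel sets of \<open>'a \<times> 'a\<close> are not known to be those of the
  product; compactness of \<open>S\<close> makes \<open>\<phi>\<close> a limit of functions of finite-precision approximations.
\<close>

lemma borel_measurable_cont_pair:
  fixes \<phi> :: "'a::metric_space \<times> 'a \<Rightarrow> real"
  assumes S: "compact S" and M: "sets M = sets (restrict_space borel S)"
    and N: "sets N = sets (restrict_space borel S)" and \<phi>: "continuous_on (S \<times> S) \<phi>"
  shows "\<phi> \<in> borel_measurable (M \<Otimes>\<^sub>M N)"
proof (cases "S = {}")
  case True
  have "space (M \<Otimes>\<^sub>M N) = {}"
    using True sets_eq_imp_space_eq[OF M] by (simp add: space_pair_measure space_restrict_space)
  then show ?thesis by (intro borel_measurableI) simp
next
  case False
  define B where "B = restrict_space (borel :: 'a measure) S"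
  have spB: "space B = S" by (simp add: B_def space_restrict_space)
  \<comment> \<open>Compactness supplies a finite net for each precision; it is enumerated with
    repetitions so that all precisions share one index type.\<close>
  have "\<exists>c :: nat \<Rightarrow> 'a. range c \<subseteq> S \<and> (\<forall>x\<in>S. \<exists>i. dist x (c i) < 1 / real (Suc n))" for n
  proof -
    have cover: "S \<subseteq> (\<Union>x\<in>S. ball x (1 / real (Suc n)))"
      by (meson UN_I centre_in_ball of_nat_0_less_iff subsetI zero_less_Suc zero_less_divide_1_iff)
    obtain C where C: "C \<subseteq> S" "finite C" "S \<subseteq> (\<Union>x\<in>C. ball x (1 / real (Suc n)))"
      using compactE_image[OF S open_ball cover] by blast
    have ne: "C \<noteq> {}" using C(3) False by auto
    have r: "range (from_nat_into C) = C"
      by (rule range_from_nat_into[OF ne countable_finite[OF C(2)]])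
    show ?thesis
    proof (intro exI[of _ "from_nat_into C"] conjI ballI)
      fix x assume "x \<in> S"
      then obtain y where "y \<in> C" "dist y x < 1 / real (Suc n)" using C(3) by auto
      moreover obtain i where "y = from_nat_into C i" using r \<open>y \<in> C\<close> by blast
      ultimately show "\<exists>i. dist x (from_nat_into C i) < 1 / real (Suc n)"
        by (metis dist_commute)
    qed (use r C in auto)
  qed
  then obtain c :: "nat \<Rightarrow> nat \<Rightarrow> 'a"
    where c: "\<And>n i. c n i \<in> S" "\<And>n x. x \<in> S \<Longrightarrow> \<exists>i. dist x (c n i) < 1 / real (Suc n)"
    by (metis rangeI subsetD)
  \<comment> \<open>Taking the least index makes the choice of net point measurable: it depends only
    on the distances to countably many fixed points.\<close>
  define j where "j n x = (LEAST i. dist x (c n i) < 1 / real (Suc n))" for n x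
  have j: "dist x (c n (j n x)) < 1 / real (Suc n)" if "x \<in> S" for n x
    unfolding j_def by (rule LeastI_ex) (rule c(2)[OF that])
  have jm: "j n \<in> measurable B (count_space UNIV)" for n
    unfolding j_def
  proof (rule measurable_Least)
    fix i
    have "(\<lambda>x. dist x (c n i)) \<in> borel_measurable B"
      unfolding B_def
      by (intro borel_measurable_continuous_on_restrict continuous_intros)
    then show "(\<lambda>x. dist x (c n i) < 1 / real (Suc n)) \<in> measurable B (count_space UNIV)"
      by measurable
  qed
  have lim: "(\<lambda>n. c n (j n x)) \<longlonglongrightarrow> x" if "x \<in> S" for x
  proof (rule metric_tendsto_imp_tendsto)
    show "(\<lambda>n. 1 / real (Suc n)) \<longlonglongrightarrow> 0" using LIMSEQ_inverse_real_of_nat by (simp add: inverse_eq_divide)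
    show "\<forall>\<^sub>F n in sequentially. dist (c n (j n x)) x \<le> dist (1 / real (Suc n)) 0"
      using j[OF that] by (auto intro!: always_eventually less_imp_le simp: dist_commute)
  qed
  \<comment> \<open>Each approximation sees \<open>z\<close> only through two natural numbers, so
    its measurability is automatic; continuity of \<open>\<phi>\<close> enters only in the passage
    to the limit.\<close>
  have "\<phi> \<in> borel_measurable (B \<Otimes>\<^sub>M B)"
  proof (rule borel_measurable_LIMSEQ_real)
    fix n
    have 1: "(\<lambda>z. j n (fst z)) \<in> measurable (B \<Otimes>\<^sub>M B) (count_space UNIV)"
      "(\<lambda>z. j n (snd z)) \<in> measurable (B \<Otimes>\<^sub>M B) (count_space UNIV)"
      using jm by measurable
    show "(\<lambda>z. \<phi> (c n (j n (fst z)), c n (j n (snd z)))) \<in> borel_measurable (B \<Otimes>\<^sub>M B)"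
      by (rule measurable_compose_countable[OF _ 1(1)], rule measurable_compose_countable[OF _ 1(2)]) simp
  next
    fix z assume "z \<in> space (B \<Otimes>\<^sub>M B)"
    then have z: "fst z \<in> S" "snd z \<in> S" by (auto simp: space_pair_measure spB)
    have "(\<lambda>n. (c n (j n (fst z)), c n (j n (snd z)))) \<longlonglongrightarrow> (fst z, snd z)"
      using z by (intro tendsto_Pair lim)
    then show "(\<lambda>n. \<phi> (c n (j n (fst z)), c n (j n (snd z)))) \<longlonglongrightarrow> \<phi> z"
      using continuous_on_tendsto_compose[OF \<phi>, of "\<lambda>n. (c n (j n (fst z)), c n (j n (snd z)))" z] z c(1)
      by (simp add: mem_Times_iff)
  qed
  moreover have "sets (M \<Otimes>\<^sub>M N) = sets (B \<Otimes>\<^sub>M B)"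
    using M N by (intro sets_pair_measure_cong) (auto simp: B_def)
  ultimately show ?thesis
    using measurable_cong_sets by blast
qed

lemma integrable_cont_pair:
  fixes \<phi> :: "'a::metric_space \<times> 'a \<Rightarrow> real"
  assumes S: "compact S" and M: "finite_measure M" "sets M = sets (restrict_space borel S)"
    and N: "finite_measure N" "sets N = sets (restrict_space borel S)" and \<phi>: "continuous_on (S \<times> S) \<phi>"
  shows "integrable (M \<Otimes>\<^sub>M N) \<phi>"
proof -
  have sp: "space (M \<Otimes>\<^sub>M N) = S \<times> S"
    using sets_eq_imp_space_eq[OF M(2)] sets_eq_imp_space_eq[OF N(2)]
    by (simp add: space_pair_measure space_restrict_space)
  have "bounded (\<phi> ` (S \<times> S))"
    using S \<phi> compact_Times compact_continuous_image compact_imp_bounded by blast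
  then obtain B where "\<And>z. z \<in> S \<times> S \<Longrightarrow> \<bar>\<phi> z\<bar> \<le> B"
    by (auto simp: bounded_iff)
  then show ?thesis
    using borel_measurable_cont_pair[OF S M(2) N(2) \<phi>] sp
    by (intro finite_measure.integrable_const_bound[OF finite_measure_pair_measure[OF N(1) M(1)]])
      (auto intro!: AE_I2)
qed

lemma pos_integral_cont:
  fixes f :: "'a::metric_space \<Rightarrow> real"
  assumes "compact S" "\<mu> \<in> borel_probs S" "pos_cont S f"
  shows "0 < (\<integral>x. f x \<partial>\<mu>)"
proof -
  note p = borel_probsD[OF assms(2)]
  interpret prob_space \<mu> by (rule p)
  obtain m M where m: "0 < m" "\<And>x. x \<in> S \<Longrightarrow> m \<le> f x"
    using pos_cont_bounds[OF assms(1,3)] by metis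
  have "m = (\<integral>x. m \<partial>\<mu>)" by (simp add: prob_space)
  also have "\<dots> \<le> (\<integral>x. f x \<partial>\<mu>)"
    using m p assms by (intro integral_mono integrable_cont_compact[OF assms(1)]) (auto simp: pos_cont_def finite_measure_axioms)
  finally show ?thesis using m by simp
qed

text \<open>Order reversing and homogeneous of degree -1 in \<open>h\<close>. The first argument of
  the kernel is always the free variable, so the second Schroedinger equation is expressed with
  \<open>q \<circ> prod.swap\<close> and every fact about the operator serves both
  equations.\<close>

definition schroedinger_op ::
    "'a measure \<Rightarrow> ('a \<times> 'a \<Rightarrow> real) \<Rightarrow> ('a \<Rightarrow> real) \<Rightarrow> 'a \<Rightarrow> real" where
  "schroedinger_op \<mu> k h x = (\<integral>y. k (x, y) / h y \<partial>\<mu>)"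

lemma continuous_on_integral_param:
  fixes \<phi> :: "'a::metric_space \<times> 'a \<Rightarrow> real"
  assumes S: "compact S" and fin: "finite_measure \<mu>" and sets: "sets \<mu> = sets (restrict_space borel S)"
    and \<phi>: "continuous_on (S \<times> S) \<phi>"
  shows "continuous_on S (\<lambda>x. \<integral>y. \<phi> (x, y) \<partial>\<mu>)"
proof -
  have sp: "space \<mu> = S"
    using sets_eq_imp_space_eq[OF sets] by (simp add: space_restrict_space)
  interpret finite_measure \<mu> by (rule fin)
  have sec: "continuous_on S (\<lambda>y. \<phi> (x, y))" if "x \<in> S" for x
    using that by (intro continuous_on_compose2[OF \<phi>] continuous_intros) auto
  have int: "integrable \<mu> (\<lambda>y. \<phi> (x, y))" if "x \<in> S" for x
    using integrable_cont_compact[OF S fin sets sec[OF that]] .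
  have "uniformly_continuous_on (S \<times> S) \<phi>"
    using compact_uniformly_continuous[OF \<phi>] S compact_Times by blast
  note uc = this[unfolded uniformly_continuous_on_def, rule_format]
  show ?thesis
    unfolding continuous_on_iff
  proof (intro ballI allI impI)
    fix x e assume x: "x \<in> S" and e: "(0::real) < e"
    \<comment> \<open>The added 1 keeps the quotient meaningful for the zero measure and makes the
      final bound strict.\<close>
    define \<epsilon> where "\<epsilon> = e / (measure \<mu> S + 1)"
    have "0 < measure \<mu> S + 1" by (simp add: add_nonneg_pos)
    then have \<epsilon>: "0 < \<epsilon>" "\<epsilon> * measure \<mu> S < e"
      using e by (auto simp: \<epsilon>_def field_simps)
    obtain d where d: "d > 0" "\<And>z z'. z \<in> S \<times> S \<Longrightarrow> z' \<in> S \<times> S \<Longrightarrow> dist z' z < d \<Longrightarrow> dist (\<phi> z') (\<phi> z) < \<epsilon>"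
      using uc[OF \<epsilon>(1)] by metis
    show "\<exists>d>0. \<forall>x'\<in>S. dist x' x < d \<longrightarrow> dist (\<integral>y. \<phi> (x', y) \<partial>\<mu>) (\<integral>y. \<phi> (x, y) \<partial>\<mu>) < e"
    proof (intro exI[of _ d] conjI ballI impI)
      fix x' assume x': "x' \<in> S" "dist x' x < d"
      have "\<bar>\<phi> (x', y) - \<phi> (x, y)\<bar> \<le> \<epsilon>" if "y \<in> S" for y
        using d(2)[of "(x,y)" "(x',y)"] x x' that by (auto simp: dist_Pair_Pair dist_real_def)
      then have "\<bar>\<integral>y. \<phi> (x', y) - \<phi> (x, y) \<partial>\<mu>\<bar> \<le> (\<integral>y. \<epsilon> \<partial>\<mu>)"
        using int[OF x] int[OF x'(1)] sp
        by (intro order_trans[OF integral_abs_bound] integral_mono) auto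
      then show "dist (\<integral>y. \<phi> (x', y) \<partial>\<mu>) (\<integral>y. \<phi> (x, y) \<partial>\<mu>) < e"
        using int[OF x] int[OF x'(1)] \<epsilon>(2) sp by (simp add: dist_real_def mult.commute)
    qed (rule d)
  qed
qed

lemma continuous_on_kernel:
  assumes "pos_cont (S \<times> S) k" "pos_cont S h"
  shows "pos_cont (S \<times> S) (\<lambda>z. k z / h (snd z))"
proof (rule pos_cont_divide[OF assms(1)])
  show "pos_cont (S \<times> S) (\<lambda>z. h (snd z))"
    using assms(2) unfolding pos_cont_def
    by (auto intro!: continuous_on_compose2[of S h] continuous_intros)
qed

lemma pos_cont_schroedinger_op:
  assumes "compact S" "\<mu> \<in> borel_probs S" "pos_cont (S \<times> S) k" "pos_cont S h"
  shows "pos_cont S (schroedinger_op \<mu> k h)"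
proof -
  have *: "pos_cont (S \<times> S) (\<lambda>z. k z / h (snd z))"
    by (rule continuous_on_kernel[OF assms(3,4)])
  then have "continuous_on S (\<lambda>x. \<integral>y. k (x, y) / h y \<partial>\<mu>)"
    using continuous_on_integral_param[OF assms(1), of \<mu> "\<lambda>z. k z / h (snd z)"] borel_probsD[OF assms(2)]
    by (simp add: pos_cont_def prob_space.finite_measure)
  moreover have "0 < (\<integral>y. k (x, y) / h y \<partial>\<mu>)" if "x \<in> S" for x
    by (rule pos_integral_cont[OF assms(1,2)] pos_cont_divide pos_cont_section assms that)+
  ultimately show ?thesis unfolding pos_cont_def schroedinger_op_def by blast
qed

lemma integrable_schroedinger_op:
  assumes "compact S" "\<mu> \<in> borel_probs S" "pos_cont (S \<times> S) k" "pos_cont S h" "x \<in> S"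
  shows "integrable \<mu> (\<lambda>y. k (x, y) / h y)"
  using pos_cont_divide[OF pos_cont_section[OF assms(3,5)] assms(4)] borel_probsD[OF assms(2)]
  by (intro integrable_cont_compact[OF assms(1)]) (auto simp: pos_cont_def prob_space.finite_measure)

lemma schroedinger_op_cong:
  assumes "\<mu> \<in> borel_probs S" "\<And>y. y \<in> S \<Longrightarrow> h y = h' y"
  shows "schroedinger_op \<mu> k h = schroedinger_op \<mu> k h'"
  unfolding schroedinger_op_def using assms borel_probsD(3)[OF assms(1)]
  by (intro ext Bochner_Integration.integral_cong) auto

lemma schroedinger_op_scale:
  "schroedinger_op \<mu> k (\<lambda>y. s * h y) x = schroedinger_op \<mu> k h x / s"
proof -
  have "(\<lambda>y. k (x, y) / (s * h y)) = (\<lambda>y. k (x, y) / h y / s)"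
    by (auto simp: fun_eq_iff mult.commute)
  then show ?thesis by (simp add: schroedinger_op_def del: divide_divide_eq_left)
qed

subsection \<open>Contraction of the kernel operator\<close>

text \<open>\<open>ln r\<close> bounds the distance of \<open>f\<close> and \<open>g\<close> in Hilbert's projective metric.\<close>

definition ratio_le :: "'a set \<Rightarrow> real \<Rightarrow> ('a \<Rightarrow> real) \<Rightarrow> ('a \<Rightarrow> real) \<Rightarrow> bool" where
  "ratio_le S r f g \<longleftrightarrow> (\<forall>x\<in>S. \<forall>y\<in>S. f x * g y \<le> r * (f y * g x))"

lemma ratio_leD: "ratio_le S r f g \<Longrightarrow> x \<in> S \<Longrightarrow> y \<in> S \<Longrightarrow> f x * g y \<le> r * (f y * g x)"
  by (simp add: ratio_le_def)

lemma ratio_le_ge_1: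
  assumes "ratio_le S r f g" "S \<noteq> {}" "\<And>x. x \<in> S \<Longrightarrow> 0 < f x" "\<And>x. x \<in> S \<Longrightarrow> 0 < g x"
  shows "1 \<le> r"
proof -
  obtain x where x: "x \<in> S" using assms(2) by blast
  have "1 * (f x * g x) \<le> r * (f x * g x)" using ratio_leD[OF assms(1) x x] by simp
  then show ?thesis using assms(3,4)[OF x] by (simp add: mult_le_cancel_right)
qed

lemma ratio_le_mono:
  assumes "ratio_le S r f g" "r \<le> r'" "\<And>x. x \<in> S \<Longrightarrow> 0 < f x" "\<And>x. x \<in> S \<Longrightarrow> 0 < g x"
  shows "ratio_le S r' f g"
  unfolding ratio_le_def
proof (intro ballI)
  fix x y assume xy: "x \<in> S" "y \<in> S"
  have "f x * g y \<le> r * (f y * g x)" by (rule ratio_leD[OF assms(1) xy])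
  also have "\<dots> \<le> r' * (f y * g x)"
    using assms(2) assms(3)[OF xy(2)] assms(4)[OF xy(1)] by (intro mult_right_mono) auto
  finally show "f x * g y \<le> r' * (f y * g x)" .
qed

lemma ratio_le_trans:
  assumes fg: "ratio_le S r f g" and gh: "ratio_le S s g h"
    and pos: "\<And>x. x \<in> S \<Longrightarrow> 0 < f x" "\<And>x. x \<in> S \<Longrightarrow> 0 < g x" "\<And>x. x \<in> S \<Longrightarrow> 0 < h x"
  shows "ratio_le S (r * s) f h"
  unfolding ratio_le_def
proof (intro ballI)
  fix x y assume xy: "x \<in> S" "y \<in> S"
  note p = pos(1)[OF xy(1)] pos(2)[OF xy(1)] pos(3)[OF xy(1)] pos(1)[OF xy(2)] pos(2)[OF xy(2)] pos(3)[OF xy(2)]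
  have "S \<noteq> {}" using xy by blast
  then have "0 \<le> r"
    using ratio_le_ge_1[OF fg _ pos(1,2)] by simp
  have "(f x * g y) * (g x * h y) \<le> (r * (f y * g x)) * (s * (g y * h x))"
    using p \<open>0 \<le> r\<close> by (intro mult_mono ratio_leD[OF fg xy] ratio_leD[OF gh xy]) auto
  then have "(f x * h y) * (g x * g y) \<le> (r * s * (f y * h x)) * (g x * g y)"
    by (simp add: algebra_simps)
  then show "f x * h y \<le> r * s * (f y * h x)"
    using p by (simp add: mult_le_cancel_right)
qed

lemma ratio_le_sym: "ratio_le S r f g \<Longrightarrow> ratio_le S r g f"
  by (auto simp: ratio_le_def mult.commute)

lemma ratio_le_cong:
  "(\<And>x. x \<in> S \<Longrightarrow> f x = f' x) \<Longrightarrow> (\<And>x. x \<in> S \<Longrightarrow> g x = g' x) \<Longrightarrow> ratio_le S r f g = ratio_le S r f' g'"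
  by (simp add: ratio_le_def)

text \<open>Finiteness of the projective distance on a compact space. It provides the first
  admissible constant from which contraction arguments start.\<close>

lemma ex_ratio_le:
  assumes "compact S" "pos_cont S f" "pos_cont S g"
  shows "\<exists>r. ratio_le S r f g"
proof -
  obtain m M where 1: "0 < m" "0 < M" "\<And>x. x \<in> S \<Longrightarrow> m \<le> f x \<and> f x \<le> M"
    using pos_cont_bounds[OF assms(1,2)] by blast
  obtain m' M' where 2: "0 < m'" "0 < M'" "\<And>x. x \<in> S \<Longrightarrow> m' \<le> g x \<and> g x \<le> M'"
    using pos_cont_bounds[OF assms(1,3)] by blast
  have "ratio_le S ((M * M') / (m * m')) f g"
    unfolding ratio_le_def
  proof (intro ballI)
    fix x y assume xy: "x \<in> S" "y \<in> S"
    have "f x * g y \<le> M * M'" "m * m' \<le> f y * g x"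
      using 1(1,2) 1(3)[OF xy(1)] 1(3)[OF xy(2)] 2(1,2) 2(3)[OF xy(1)] 2(3)[OF xy(2)]
      by (auto intro!: mult_mono)
    moreover from this(2) have "(M * M') / (m * m') * (m * m') \<le> (M * M') / (m * m') * (f y * g x)"
      using 1 2 by (intro mult_left_mono) auto
    ultimately show "f x * g y \<le> (M * M') / (m * m') * (f y * g x)"
      using 1 2 by simp
  qed
  then show ?thesis by blast
qed

text \<open>
  The bound \<open>r * F x' / G x'\<close> dominates \<open>g / f\<close> everywhere, and the gap to it is integrated against
  kernels that are comparable up to the factor \<open>m / M\<close>.
\<close>

lemma ratio_le_schroedinger_op:
  assumes S: "compact S" and \<mu>: "\<mu> \<in> borel_probs S" and k: "pos_cont (S \<times> S) k"
    and m: "0 < m" "\<And>z. z \<in> S \<times> S \<Longrightarrow> m \<le> k z \<and> k z \<le> M"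
    and f: "pos_cont S f" and g: "pos_cont S g" and r: "ratio_le S r f g"
  shows "ratio_le S (r - (m / M)\<^sup>2 * (r - 1)) (schroedinger_op \<mu> k f) (schroedinger_op \<mu> k g)"
  unfolding ratio_le_def
proof (intro ballI)
  fix x x' assume x: "x \<in> S" and x': "x' \<in> S"
  note p = borel_probsD[OF \<mu>]
  let ?F = "schroedinger_op \<mu> k f" and ?G = "schroedinger_op \<mu> k g"
  have fp: "\<And>x. x \<in> S \<Longrightarrow> 0 < f x" and gp: "\<And>x. x \<in> S \<Longrightarrow> 0 < g x"
    using f g by (auto simp: pos_cont_def)
  have FG: "0 < ?F x" "0 < ?F x'" "0 < ?G x" "0 < ?G x'"
    using pos_cont_schroedinger_op[OF S \<mu> k f] pos_cont_schroedinger_op[OF S \<mu> k g] x x'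
    by (auto simp: pos_cont_def)
  have r1: "1 \<le> r" by (rule ratio_le_ge_1[OF r p(4) fp gp])
  have M: "0 < M" using m(1) m(2)[of "(x, x)"] x by auto
  have kk: "m / M * k (a, y) \<le> k (b, y)" if "a \<in> S" "b \<in> S" "y \<in> S" for a b y
  proof -
    have "m / M * k (a, y) \<le> m / M * M" using m M that by (intro mult_left_mono) auto
    also have "\<dots> \<le> k (b, y)" using m M that by auto
    finally show ?thesis .
  qed
  note int = integrable_schroedinger_op[OF S \<mu> k]
  define b where "b = r * ?F x' / ?G x'"
  have bG: "b * ?G x' = r * ?F x'" using FG by (simp add: b_def)
  \<comment> \<open>Integrating the ratio bound for the pair \<open>z\<close>, \<open>y\<close>
    against \<open>k (x', z)\<close> replaces the values at \<open>z\<close> by \<open>?F x'\<close>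
    and \<open>?G x'\<close> and leaves a bound on \<open>g y / f y\<close>.\<close>
  have gap: "0 \<le> b / g y - 1 / f y" if y: "y \<in> S" for y
  proof -
    have "(\<integral>z. g y * (k (x', z) / g z) \<partial>\<mu>) \<le> (\<integral>z. (r * f y) * (k (x', z) / f z) \<partial>\<mu>)"
    proof (rule integral_mono)
      fix z assume "z \<in> space \<mu>"
      then have z: "z \<in> S" using p by simp
      have "k (x', z) * (f z * g y) \<le> k (x', z) * (r * (f y * g z))"
        using m(1) m(2)[of "(x',z)"] x' z by (intro mult_left_mono ratio_leD[OF r z y]) auto
      then show "g y * (k (x', z) / g z) \<le> (r * f y) * (k (x', z) / f z)"
        using fp[OF z] gp[OF z] by (simp add: field_simps)
    qed (intro integrable_mult_right int f g x')+
    then have "g y * ?G x' \<le> r * f y * ?F x'"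
      by (simp add: schroedinger_op_def del: times_divide_eq_right)
    then show ?thesis
      using FG fp[OF y] gp[OF y] by (simp add: b_def field_simps)
  qed
  have gapint: "integrable \<mu> (\<lambda>y. k (a, y) * (b / g y - 1 / f y))"
      "(\<integral>y. k (a, y) * (b / g y - 1 / f y) \<partial>\<mu>) = b * ?G a - ?F a" if "a \<in> S" for a
  proof -
    have *: "(\<lambda>y. k (a, y) * (b / g y - 1 / f y)) = (\<lambda>y. b * (k (a, y) / g y) - k (a, y) / f y)"
      by (auto simp: algebra_simps)
    show "integrable \<mu> (\<lambda>y. k (a, y) * (b / g y - 1 / f y))"
      unfolding * by (intro Bochner_Integration.integrable_diff integrable_mult_right int f g that)
    show "(\<integral>y. k (a, y) * (b / g y - 1 / f y) \<partial>\<mu>) = b * ?G a - ?F a"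
      unfolding * using int[OF f that] int[OF g that]
      by (simp add: schroedinger_op_def del: times_divide_eq_right)
  qed
  \<comment> \<open>Because the gap is nonnegative, passing from the kernel at \<open>x'\<close> to
    the kernel at \<open>x\<close> loses at most the factor \<open>m / M\<close>. At
    \<open>x'\<close> the integrated gap is \<open>(r - 1) * ?F x'\<close>.\<close>
  have "(\<integral>y. m / M * (k (x', y) * (b / g y - 1 / f y)) \<partial>\<mu>) \<le> (\<integral>y. k (x, y) * (b / g y - 1 / f y) \<partial>\<mu>)"
  proof (rule integral_mono)
    fix y assume "y \<in> space \<mu>"
    then have y: "y \<in> S" using p by simp
    show "m / M * (k (x', y) * (b / g y - 1 / f y)) \<le> k (x, y) * (b / g y - 1 / f y)"
      using mult_right_mono[OF kk[OF x' x y] gap[OF y]] by (simp only: mult.assoc)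
  qed (use gapint x x' in auto)
  then have 1: "m / M * (b * ?G x' - ?F x') \<le> b * ?G x - ?F x"
    using gapint(2)[OF x] gapint(2)[OF x'] by simp
  have "(\<integral>y. m / M * (k (x, y) / g y) \<partial>\<mu>) \<le> (\<integral>y. k (x', y) / g y \<partial>\<mu>)"
  proof (rule integral_mono)
    fix y assume "y \<in> space \<mu>"
    then have y: "y \<in> S" using p by simp
    show "m / M * (k (x, y) / g y) \<le> k (x', y) / g y"
      using divide_right_mono[OF kk[OF x x' y]] gp[OF y] by (simp add: less_imp_le)
  qed (intro integrable_mult_right int g x x')+
  then have 2: "m / M * ?G x \<le> ?G x'"
    by (simp add: schroedinger_op_def del: times_divide_eq_right times_divide_eq_left)
  \<comment> \<open>Origin of the square: one factor \<open>m / M\<close> comes from comparing the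
    integrated gaps at \<open>x\<close> and \<open>x'\<close>, the other from trading
    \<open>?G x\<close> for \<open>?G x'\<close>.\<close>
  have "(m / M)\<^sup>2 * (r - 1) * (?F x' * ?G x) = m / M * (r - 1) * ?F x' * (m / M * ?G x)"
    by (simp only: power2_eq_square mult_ac)
  also have "\<dots> \<le> m / M * (r - 1) * ?F x' * ?G x'"
    using 2 m M r1 FG by (intro mult_left_mono) auto
  also have "\<dots> = m / M * (b * ?G x' - ?F x') * ?G x'"
    by (simp only: bG left_diff_distrib mult_1 mult.assoc)
  also have "\<dots> \<le> (b * ?G x - ?F x) * ?G x'"
    using 1 FG by (intro mult_right_mono) auto
  also have "\<dots> = r * (?F x' * ?G x) - ?F x * ?G x'"
    using bG by (simp add: algebra_simps)
  finally show "?F x * ?G x' \<le> (r - (m / M)\<^sup>2 * (r - 1)) * (?F x' * ?G x)"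
    by (simp add: algebra_simps)
qed

text \<open>With \<open>E = 1\<close> this gives uniqueness of fixed points, with \<open>E\<close> near \<open>1\<close> their stability.\<close>

lemma ratio_le_of_contraction:
  assumes S: "S \<noteq> {}" "\<And>x. x \<in> S \<Longrightarrow> 0 < f x" "\<And>x. x \<in> S \<Longrightarrow> 0 < g x"
    and ex: "ratio_le S r0 f g"
    and step: "\<And>r. ratio_le S r f g \<Longrightarrow> ratio_le S ((r - c * (r - 1)) * E) f g"
    and c: "(1 - c) * E < 1"
  shows "ratio_le S (c * E / (1 - (1 - c) * E)) f g"
proof -
  let ?A = "{r. ratio_le S r f g}"
  have ne: "?A \<noteq> {}" using ex by auto
  have bdd: "bdd_below ?A"
    using ratio_le_ge_1[OF _ S] by (auto intro!: bdd_belowI[of _ 1])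
  \<comment> \<open>The infimum is itself admissible, since each defining inequality is closed in
    \<open>r\<close>.\<close>
  have "ratio_le S (Inf ?A) f g"
    unfolding ratio_le_def[of S "Inf ?A"]
  proof (intro ballI)
    fix x y assume xy: "x \<in> S" "y \<in> S"
    have p: "0 < f y * g x" using S xy by simp
    have "f x * g y / (f y * g x) \<le> Inf ?A"
      using ratio_leD[OF _ xy] by (intro cInf_greatest[OF ne]) (simp add: pos_divide_le_eq[OF p])
    then show "f x * g y \<le> Inf ?A * (f y * g x)"
      using p by (simp add: pos_divide_le_eq)
  qed
  \<comment> \<open>One step applied to the best constant cannot improve it. The resulting linear
    inequality for \<open>Inf ?A\<close> is solved, which needs
    \<open>(1 - c) * E < 1\<close>.\<close>
  moreover from step[OF this] have "Inf ?A \<le> (Inf ?A - c * (Inf ?A - 1)) * E"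
    by (intro cInf_lower bdd) simp
  then have "Inf ?A \<le> c * E / (1 - (1 - c) * E)"
    using c by (simp add: pos_le_divide_eq algebra_simps)
  ultimately show ?thesis using ratio_le_mono S by blast
qed

subsection \<open>Convergence in norm and uniform convergence\<close>

text \<open>Convergence in the dual norm without a supremum: a real supremum carries information
  only after boundedness is checked, whereas here one late \<open>n\<close> serves all test
  functions at once.\<close>

definition norm_conv :: "'a::topological_space set \<Rightarrow> (nat \<Rightarrow> 'a measure) \<Rightarrow> 'a measure \<Rightarrow> bool" where
  "norm_conv X \<mu>n \<mu> \<longleftrightarrow> (\<forall>\<epsilon>>0. \<forall>\<^sub>F n in sequentially. \<forall>\<phi> :: 'a \<Rightarrow> real.
     continuous_on X \<phi> \<and> (\<forall>x\<in>X. \<bar>\<phi> x\<bar> \<le> 1) \<longrightarrow> \<bar>(\<integral>x. \<phi> x \<partial>\<mu>n n) - (\<integral>x. \<phi> x \<partial>\<mu>)\<bar> \<le> \<epsilon>)"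

lemma norm_conv_const: "norm_conv X (\<lambda>_. \<mu>) \<mu>"
  by (simp add: norm_conv_def)

lemma norm_convD:
  assumes "norm_conv X \<mu>n \<mu>" "0 < \<epsilon>" "0 < B"
  shows "\<forall>\<^sub>F n in sequentially. \<forall>\<phi> :: 'a::topological_space \<Rightarrow> real.
     continuous_on X \<phi> \<and> (\<forall>x\<in>X. \<bar>\<phi> x\<bar> \<le> B) \<longrightarrow> \<bar>(\<integral>x. \<phi> x \<partial>\<mu>n n) - (\<integral>x. \<phi> x \<partial>\<mu>)\<bar> \<le> \<epsilon>"
proof -
  have "0 < \<epsilon> / B" using assms by simp
  from assms(1)[unfolded norm_conv_def, rule_format, OF this] show ?thesis
  proof eventually_elim
    case (elim n)
    show ?case
    proof (intro allI impI)
      fix \<phi> :: "'a \<Rightarrow> real" assume \<phi>: "continuous_on X \<phi> \<and> (\<forall>x\<in>X. \<bar>\<phi> x\<bar> \<le> B)"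
      then have "continuous_on X (\<lambda>x. \<phi> x / B) \<and> (\<forall>x\<in>X. \<bar>\<phi> x / B\<bar> \<le> 1)"
        using assms(3) by (auto intro!: continuous_intros simp: abs_divide)
      from elim[rule_format, OF this]
      have "\<bar>(\<integral>x. \<phi> x \<partial>\<mu>n n) - (\<integral>x. \<phi> x \<partial>\<mu>)\<bar> / B \<le> \<epsilon> / B"
        using assms(3) by (simp add: diff_divide_distrib[symmetric] abs_divide)
      then show "\<bar>(\<integral>x. \<phi> x \<partial>\<mu>n n) - (\<integral>x. \<phi> x \<partial>\<mu>)\<bar> \<le> \<epsilon>"
        using assms(3) by (simp add: divide_le_cancel)
    qed
  qed
qed

text \<open>Two errors are separated. Changing the integrand costs at most its uniform error,
  because \<open>\<mu>n n\<close> has mass one. Changing the measure is a test against the section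
  of \<open>\<phi>\<close> at \<open>x\<close>; all sections share one bound \<open>B\<close>, which
  makes the estimate uniform in \<open>x\<close>.\<close>

lemma uniform_limit_integral_param:
  fixes \<phi>n :: "nat \<Rightarrow> 'a::metric_space \<times> 'a \<Rightarrow> real"
  assumes S: "compact S" and \<mu>n: "\<forall>\<^sub>F n in sequentially. \<mu>n n \<in> borel_probs S"
    and conv: "norm_conv S \<mu>n \<mu>"
    and \<phi>n: "\<forall>\<^sub>F n in sequentially. continuous_on (S \<times> S) (\<phi>n n)" and \<phi>: "continuous_on (S \<times> S) \<phi>"
    and lim: "uniform_limit (S \<times> S) \<phi>n \<phi> sequentially"
  shows "uniform_limit S (\<lambda>n x. \<integral>y. \<phi>n n (x, y) \<partial>\<mu>n n) (\<lambda>x. \<integral>y. \<phi> (x, y) \<partial>\<mu>) sequentially"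
proof (rule uniform_limitI)
  fix e :: real assume e: "0 < e"
  have "bounded (\<phi> ` (S \<times> S))"
    using S \<phi> compact_Times compact_continuous_image compact_imp_bounded by blast
  then obtain B where B: "0 < B" "\<And>z. z \<in> S \<times> S \<Longrightarrow> \<bar>\<phi> z\<bar> \<le> B"
    by (auto simp: bounded_pos)
  have e3: "0 < e / 3" using e by simp
  show "\<forall>\<^sub>F n in sequentially. \<forall>x\<in>S. dist (\<integral>y. \<phi>n n (x, y) \<partial>\<mu>n n) (\<integral>y. \<phi> (x, y) \<partial>\<mu>) < e"
    using \<mu>n \<phi>n norm_convD[OF conv e3 B(1)] uniform_limitD[OF lim e3]
  proof eventually_elim
    case (elim n)
    note p = borel_probsD[OF elim(1)]
    interpret prob_space "\<mu>n n" by (rule p)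
    show ?case
    proof
      fix x assume x: "x \<in> S"
      have sec: "continuous_on S (\<lambda>y. \<psi> (x, y))" if "continuous_on (S \<times> S) \<psi>" for \<psi> :: "'a \<times> 'a \<Rightarrow> real"
        using x by (intro continuous_on_compose2[OF that] continuous_intros) auto
      have int: "integrable (\<mu>n n) (\<lambda>y. \<psi> (x, y))" if "continuous_on (S \<times> S) \<psi>" for \<psi> :: "'a \<times> 'a \<Rightarrow> real"
        using integrable_cont_compact[OF S finite_measure_axioms p(2) sec[OF that]] .
      have "\<bar>\<integral>y. \<phi>n n (x, y) - \<phi> (x, y) \<partial>\<mu>n n\<bar> \<le> (\<integral>y. e / 3 \<partial>\<mu>n n)"
        using int[OF elim(2)] int[OF \<phi>] x elim(4) p(3)
        by (intro order_trans[OF integral_abs_bound] integral_mono)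
           (auto simp: dist_real_def intro!: less_imp_le)
      then have 1: "\<bar>(\<integral>y. \<phi>n n (x, y) \<partial>\<mu>n n) - (\<integral>y. \<phi> (x, y) \<partial>\<mu>n n)\<bar> \<le> e / 3"
        using int[OF elim(2)] int[OF \<phi>] by (simp add: prob_space)
      have 2: "\<bar>(\<integral>y. \<phi> (x, y) \<partial>\<mu>n n) - (\<integral>y. \<phi> (x, y) \<partial>\<mu>)\<bar> \<le> e / 3"
        using elim(3) sec[OF \<phi>] B(2) x by auto
      show "dist (\<integral>y. \<phi>n n (x, y) \<partial>\<mu>n n) (\<integral>y. \<phi> (x, y) \<partial>\<mu>) < e"
        using 1 2 e unfolding dist_real_def by linarith
    qed
  qed
qed

lemma uniform_limit_divide_pos_cont:
  fixes f :: "'b::topological_space \<Rightarrow> real"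
  assumes "compact X" "continuous_on X f" "pos_cont X g"
    and "uniform_limit X fn f F" "uniform_limit X gn g F"
  shows "uniform_limit X (\<lambda>n x. fn n x / gn n x) (\<lambda>x. f x / g x) F"
proof -
  obtain m M where m: "0 < m" "\<And>x. x \<in> X \<Longrightarrow> m \<le> g x" using pos_cont_bounds[OF assms(1,3)] by metis
  have "bounded (f ` X)" using assms compact_continuous_image compact_imp_bounded by blast
  moreover have "m \<le> norm (g x)" if "x \<in> X" for x using m(1) m(2)[OF that] by simp
  ultimately show ?thesis using assms m(1) by (intro uniform_lim_divide) auto
qed

text \<open>Joint continuity of the operator in measure, kernel and argument. With fixed measure and
  kernel it lets the iteration pass to the limit; with varying ones it shows that the perturbed map
  nearly fixes the limiting potential.\<close>

lemma uniform_limit_schroedinger_op: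
  assumes S: "compact S" and \<mu>n: "\<forall>\<^sub>F n in sequentially. \<mu>n n \<in> borel_probs S"
    and conv: "norm_conv S \<mu>n \<mu>"
    and kn: "\<forall>\<^sub>F n in sequentially. pos_cont (S \<times> S) (kn n)" and k: "pos_cont (S \<times> S) k"
    and klim: "uniform_limit (S \<times> S) kn k sequentially"
    and hn: "\<forall>\<^sub>F n in sequentially. pos_cont S (hn n)" and h: "pos_cont S h"
    and hlim: "uniform_limit S hn h sequentially"
  shows "uniform_limit S (\<lambda>n. schroedinger_op (\<mu>n n) (kn n) (hn n)) (schroedinger_op \<mu> k h) sequentially"
proof -
  have "uniform_limit (S \<times> S) (\<lambda>n z. hn n (snd z)) (\<lambda>z. h (snd z)) sequentially"
    by (rule uniform_limit_compose'[OF hlim]) auto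
  moreover have "pos_cont (S \<times> S) (\<lambda>z. h (snd z))"
    using h unfolding pos_cont_def by (auto intro!: continuous_on_compose2[of S h] continuous_intros)
  ultimately have lim: "uniform_limit (S \<times> S) (\<lambda>n z. kn n z / hn n (snd z)) (\<lambda>z. k z / h (snd z)) sequentially"
    using S k klim by (intro uniform_limit_divide_pos_cont compact_Times) (auto simp: pos_cont_def)
  have "\<forall>\<^sub>F n in sequentially. continuous_on (S \<times> S) (\<lambda>z. kn n z / hn n (snd z))"
    using kn hn by eventually_elim (use continuous_on_kernel in \<open>auto simp: pos_cont_def\<close>)
  from uniform_limit_integral_param[OF S \<mu>n conv this _ lim] show ?thesis
    using continuous_on_kernel[OF k h] by (simp add: pos_cont_def schroedinger_op_def[abs_def])
qed

text \<open>The contraction rate depends on the kernel only through its lower and upper bounds, so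
  common bounds give one rate for all late kernels. They also keep the arguments of the logarithm in
  one compact interval of positive numbers.\<close>

lemma uniform_limit_pos_bounds:
  assumes "compact X" "pos_cont X f" "uniform_limit X fn f F"
  obtains m M :: real where "0 < m" "0 < M" "\<forall>\<^sub>F n in F. \<forall>x\<in>X. m \<le> fn n x \<and> fn n x \<le> M"
proof -
  obtain m M where m: "0 < m" "0 < M" "\<And>x. x \<in> X \<Longrightarrow> m \<le> f x \<and> f x \<le> M"
    using pos_cont_bounds[OF assms(1,2)] by metis
  have "0 < m / 2" using m by simp
  from uniform_limitD[OF assms(3) this]
  have "\<forall>\<^sub>F n in F. \<forall>x\<in>X. m / 2 \<le> fn n x \<and> fn n x \<le> M + m"
  proof eventually_elim
    case (elim n)
    show ?case
    proof
      fix x assume x: "x \<in> X"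
      show "m / 2 \<le> fn n x \<and> fn n x \<le> M + m"
        using bspec[OF elim x] m(3)[OF x] m(1) unfolding dist_real_def by linarith
    qed
  qed
  then show ?thesis using that[of "m / 2" "M + m"] m by simp
qed

lemma uniform_limit_imp_ratio_le:
  assumes X: "compact X" "pos_cont X f" and lim: "uniform_limit X fn f F" and r: "1 < r"
  shows "\<forall>\<^sub>F n in F. ratio_le X r (fn n) f"
proof -
  obtain m M where m: "0 < m" "\<And>x. x \<in> X \<Longrightarrow> m \<le> f x"
    using pos_cont_bounds[OF X] by metis
  \<comment> \<open>Chosen so that \<open>(m + d) / (m - d) = r\<close>: a uniform error
    \<open>d\<close> on a function that is at least \<open>m\<close> changes quotients of values by
    at most the factor \<open>r\<close>.\<close>
  define d where "d = m * (r - 1) / (r + 1)"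
  have d: "0 < d" "m * (r - 1) = d * (r + 1)" using m r by (auto simp: d_def)
  from uniform_limitD[OF lim d(1)] show ?thesis
  proof eventually_elim
    case (elim n)
    show ?case unfolding ratio_le_def
    proof (intro ballI)
      fix x y assume x: "x \<in> X" and y: "y \<in> X"
      have f: "0 < f x" "0 < f y" using X(2) x y by (auto simp: pos_cont_def)
      have "fn n x \<le> f x + d" "f y - d \<le> fn n y"
        using bspec[OF elim x] bspec[OF elim y] unfolding dist_real_def by linarith+
      moreover have q: "d * (r + 1) \<le> (r - 1) * f x" "d * (r + 1) \<le> (r - 1) * f y"
        using mult_right_mono[OF m(2)[OF x], of "r - 1"] mult_right_mono[OF m(2)[OF y], of "r - 1"] d(2) r
        by (simp_all add: mult.commute)
      ultimately have a: "fn n x * (r + 1) \<le> 2 * r * f x" and b: "2 * f y \<le> fn n y * (r + 1)"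
        using mult_right_mono[of "fn n x" "f x + d" "r + 1"] mult_right_mono[of "f y - d" "fn n y" "r + 1"] r
        by (auto simp: algebra_simps)
      have "fn n x * (r + 1) * f y \<le> 2 * r * f x * f y"
        using a f by (intro mult_right_mono) auto
      also have "\<dots> = r * f x * (2 * f y)" by simp
      also have "\<dots> \<le> r * f x * (fn n y * (r + 1))"
        using b f r by (intro mult_left_mono) auto
      finally have "(fn n x * f y) * (r + 1) \<le> (r * (fn n y * f x)) * (r + 1)"
        by (simp add: algebra_simps)
      then show "fn n x * f y \<le> r * (fn n y * f x)"
        using r by (simp add: mult_le_cancel_right)
    qed
  qed
qed

text \<open>Projective convergence becomes uniform once one value is fixed: after rescaling, both
  functions agree at \<open>x0\<close>, and taking \<open>x0\<close> as one of the two points in the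
  ratio bound controls every other point.\<close>

lemma ratio_le_imp_uniform_limit:
  assumes X: "compact X" "pos_cont X f" and x0: "x0 \<in> X"
    and fn: "\<forall>\<^sub>F n in F. pos_cont X (fn n)"
    and lim: "\<And>r. 1 < r \<Longrightarrow> \<forall>\<^sub>F n in F. ratio_le X r (fn n) f"
  shows "uniform_limit X (\<lambda>n x. f x0 / fn n x0 * fn n x) f F"
proof (rule uniform_limitI)
  fix e :: real assume e: "0 < e"
  obtain m M where M: "0 < M" "\<And>x. x \<in> X \<Longrightarrow> f x \<le> M"
    using pos_cont_bounds[OF X] by metis
  \<comment> \<open>The relative error \<open>r - 1\<close> times the bound \<open>M\<close> is
    \<open>e / 2\<close>.\<close>
  define r where "r = 1 + e / (2 * M)"
  have r: "1 < r" "(r - 1) * M < e" using e M by (auto simp: r_def)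
  show "\<forall>\<^sub>F n in F. \<forall>x\<in>X. dist (f x0 / fn n x0 * fn n x) (f x) < e"
    using fn lim[OF r(1)]
  proof eventually_elim
    case (elim n)
    show ?case
    proof
      fix x assume x: "x \<in> X"
      have p: "0 < f x" "0 < f x0" "0 < fn n x" "0 < fn n x0"
        using X elim(1) x x0 by (auto simp: pos_cont_def)
      let ?h = "f x0 / fn n x0 * fn n x"
      have 1: "?h \<le> r * f x"
        using ratio_leD[OF elim(2) x x0] p by (simp add: field_simps)
      have "f x \<le> r * ?h"
        using ratio_leD[OF elim(2) x0 x] p by (simp add: field_simps)
      \<comment> \<open>This is \<open>2 - r \<le> 1 / r\<close>, that is, a square is nonnegative.
        It gives the lower estimate the same width \<open>(r - 1) * f x\<close> as the upper
        one.\<close>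
      moreover have "f x * (2 - r) * r \<le> f x"
      proof -
        have "f x * ((2 - r) * r) \<le> f x * 1"
        proof (rule mult_left_mono)
          show "(2 - r) * r \<le> 1" using zero_le_power2[of "r - 1"] by (simp add: power2_eq_square algebra_simps)
        qed (use p in simp)
        then show ?thesis by (simp add: mult.assoc)
      qed
      ultimately have "f x * (2 - r) * r \<le> ?h * r" by (simp add: mult.commute)
      then have 2: "f x * (2 - r) \<le> ?h" using r by (simp only: mult_le_cancel_right)
      have 3: "(r - 1) * f x \<le> (r - 1) * M" using M(2)[OF x] r by (intro mult_left_mono) auto
      have "?h - f x \<le> (r - 1) * f x" "f x - ?h \<le> (r - 1) * f x"
        using 1 2 by (simp_all add: algebra_simps)
      then show "dist ?h (f x) < e"
        using 3 r(2) unfolding dist_real_def by linarith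
    qed
  qed
qed

subsection \<open>Existence and uniqueness of the potentials\<close>

text \<open>The last equation is the normalization \<open>\<nu>\<^sub>1 S = \<nu>\<^sub>2 S\<close>
  expressed through the densities \<open>1 / f\<close> and \<open>1 / g\<close>. Values outside
  \<open>S\<close> are left free, so identities between potentials can hold only on
  \<open>S\<close>.\<close>

definition schroedinger_potentials ::
    "'a::metric_space set \<Rightarrow> ('a \<times> 'a \<Rightarrow> real) \<Rightarrow> 'a measure \<Rightarrow> 'a measure
      \<Rightarrow> ('a \<Rightarrow> real) \<Rightarrow> ('a \<Rightarrow> real) \<Rightarrow> bool" where
  "schroedinger_potentials S q \<mu>\<^sub>1 \<mu>\<^sub>2 f g \<longleftrightarrow> pos_cont S f \<and> pos_cont S g \<and>
     (\<forall>x\<in>S. f x = schroedinger_op \<mu>\<^sub>2 q g x) \<and>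
     (\<forall>y\<in>S. g y = schroedinger_op \<mu>\<^sub>1 (q \<circ> prod.swap) f y) \<and>
     (\<integral>x. 1 / f x \<partial>\<mu>\<^sub>1) = (\<integral>y. 1 / g y \<partial>\<mu>\<^sub>2)"

text \<open>One full cycle of the Fortet-Sinkhorn iteration, with \<open>g\<close> eliminated.
  Composing two operators of degree -1 makes scaling pass through unchanged.\<close>

definition round_trip ::
    "('a \<times> 'a \<Rightarrow> real) \<Rightarrow> 'a measure \<Rightarrow> 'a measure \<Rightarrow> ('a \<Rightarrow> real) \<Rightarrow> 'a \<Rightarrow> real" where
  "round_trip q \<mu>\<^sub>1 \<mu>\<^sub>2 f = schroedinger_op \<mu>\<^sub>2 q (schroedinger_op \<mu>\<^sub>1 (q \<circ> prod.swap) f)"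

lemma pos_cont_round_trip:
  assumes "compact S" "\<mu>\<^sub>1 \<in> borel_probs S" "\<mu>\<^sub>2 \<in> borel_probs S" "pos_cont (S \<times> S) q" "pos_cont S f"
  shows "pos_cont S (round_trip q \<mu>\<^sub>1 \<mu>\<^sub>2 f)"
  unfolding round_trip_def by (intro pos_cont_schroedinger_op pos_cont_swap assms)

lemma round_trip_scale:
  "round_trip q \<mu>\<^sub>1 \<mu>\<^sub>2 (\<lambda>x. s * f x) y = s * round_trip q \<mu>\<^sub>1 \<mu>\<^sub>2 f y"
proof -
  have "schroedinger_op \<mu>\<^sub>1 (q \<circ> prod.swap) (\<lambda>x. s * f x) = (\<lambda>x. inverse s * schroedinger_op \<mu>\<^sub>1 (q \<circ> prod.swap) f x)"
    by (simp add: schroedinger_op_scale fun_eq_iff divide_inverse mult.commute)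
  then show ?thesis
    by (simp add: round_trip_def schroedinger_op_scale divide_inverse mult.commute)
qed

text \<open>Both halves of the cycle contract, but one factor is enough: the second half is used
  only as not increasing the constant, which requires that the constant after the first half is
  still at least 1.\<close>

lemma ratio_le_round_trip:
  assumes S: "compact S" and \<mu>: "\<mu>\<^sub>1 \<in> borel_probs S" "\<mu>\<^sub>2 \<in> borel_probs S" and q: "pos_cont (S \<times> S) q"
    and m: "0 < m" "\<And>z. z \<in> S \<times> S \<Longrightarrow> m \<le> q z \<and> q z \<le> M"
    and f: "pos_cont S f" and g: "pos_cont S g" and r: "ratio_le S r f g"
  shows "ratio_le S (r - (m / M)\<^sup>2 * (r - 1)) (round_trip q \<mu>\<^sub>1 \<mu>\<^sub>2 f) (round_trip q \<mu>\<^sub>1 \<mu>\<^sub>2 g)"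
proof -
  note q' = pos_cont_swap[OF q]
  let ?f = "schroedinger_op \<mu>\<^sub>1 (q \<circ> prod.swap) f" and ?g = "schroedinger_op \<mu>\<^sub>1 (q \<circ> prod.swap) g"
  let ?r = "r - (m / M)\<^sup>2 * (r - 1)"
  have f': "pos_cont S ?f" and g': "pos_cont S ?g"
    by (intro pos_cont_schroedinger_op[OF S \<mu>(1) q'] f g)+
  have "ratio_le S ?r ?f ?g"
    by (rule ratio_le_schroedinger_op[OF S \<mu>(1) q' m(1) _ f g r]) (use m in auto)
  moreover from this have "1 \<le> ?r"
    using f' g' borel_probsD(4)[OF \<mu>(1)] by (intro ratio_le_ge_1[of S ?r ?f ?g]) (auto simp: pos_cont_def)
  ultimately have "ratio_le S (?r - (m / M)\<^sup>2 * (?r - 1)) (round_trip q \<mu>\<^sub>1 \<mu>\<^sub>2 f) (round_trip q \<mu>\<^sub>1 \<mu>\<^sub>2 g)"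
    unfolding round_trip_def by (intro ratio_le_schroedinger_op[OF S \<mu>(2) q m f' g'])
  then show ?thesis
  proof (rule ratio_le_mono)
    show "?r - (m / M)\<^sup>2 * (?r - 1) \<le> ?r" using \<open>1 \<le> ?r\<close> by simp
  qed (use pos_cont_round_trip[OF S \<mu> q f] pos_cont_round_trip[OF S \<mu> q g] in \<open>auto simp: pos_cont_def\<close>)
qed

lemma round_trip_potentials:
  assumes "\<mu>\<^sub>2 \<in> borel_probs S" "schroedinger_potentials S q \<mu>\<^sub>1 \<mu>\<^sub>2 f g" "x \<in> S"
  shows "round_trip q \<mu>\<^sub>1 \<mu>\<^sub>2 f x = f x"
proof -
  have "round_trip q \<mu>\<^sub>1 \<mu>\<^sub>2 f = schroedinger_op \<mu>\<^sub>2 q g"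
    unfolding round_trip_def using assms(2)
    by (intro schroedinger_op_cong[OF assms(1)]) (auto simp: schroedinger_potentials_def)
  then show ?thesis using assms(2,3) by (simp add: schroedinger_potentials_def)
qed

text \<open>Contraction makes \<open>f'\<close> a multiple \<open>s * f\<close>, whence
  \<open>g' = g / s\<close> on \<open>S\<close>. The normalization then reads
  \<open>1 / s = s\<close> times a common positive integral, and positivity leaves
  \<open>s = 1\<close>.\<close>

lemma schroedinger_potentials_unique:
  assumes S: "compact S" and \<mu>: "\<mu>\<^sub>1 \<in> borel_probs S" "\<mu>\<^sub>2 \<in> borel_probs S" and q: "pos_cont (S \<times> S) q"
    and fg: "schroedinger_potentials S q \<mu>\<^sub>1 \<mu>\<^sub>2 f g" and fg': "schroedinger_potentials S q \<mu>\<^sub>1 \<mu>\<^sub>2 f' g'"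
    and x: "x \<in> S"
  shows "f x = f' x" "g x = g' x"
proof -
  note p1 = borel_probsD[OF \<mu>(1)] and p2 = borel_probsD[OF \<mu>(2)]
  obtain m M where m: "0 < m" "0 < M" "\<And>z. z \<in> S \<times> S \<Longrightarrow> m \<le> q z \<and> q z \<le> M"
    using pos_cont_bounds[OF compact_Times[OF S S] q] by metis
  have pc: "pos_cont S f" "pos_cont S f'" "pos_cont S g" "pos_cont S g'"
    using fg fg' by (auto simp: schroedinger_potentials_def)
  then have pos: "\<And>x. x \<in> S \<Longrightarrow> 0 < f x" "\<And>x. x \<in> S \<Longrightarrow> 0 < f' x"
      "\<And>x. x \<in> S \<Longrightarrow> 0 < g x" "\<And>x. x \<in> S \<Longrightarrow> 0 < g' x"
    by (auto simp: pos_cont_def)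
  obtain r0 where r0: "ratio_le S r0 f f'" using ex_ratio_le[OF S pc(1,2)] by blast
  have c: "0 < (m / M)\<^sup>2" using m by simp
  \<comment> \<open>Both functions are exact fixed points, so the cost \<open>E\<close> of a
    perturbation is 1 and the bound collapses to 1, which means proportionality.\<close>
  have "ratio_le S ((m / M)\<^sup>2 * 1 / (1 - (1 - (m / M)\<^sup>2) * 1)) f f'"
  proof (rule ratio_le_of_contraction[OF p1(4) pos(1,2) r0])
    fix r assume "ratio_le S r f f'"
    from ratio_le_round_trip[OF S \<mu> q m(1,3) pc(1,2) this]
    show "ratio_le S ((r - (m / M)\<^sup>2 * (r - 1)) * 1) f f'"
      using round_trip_potentials[OF \<mu>(2) fg] round_trip_potentials[OF \<mu>(2) fg']
      by (subst mult_1_right) (simp cong: ratio_le_cong)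
  qed (use c in auto)
  then have "ratio_le S 1 f f'" using c m by simp
  note le = ratio_leD[OF this]
  define s where "s = f' x / f x"
  have s: "0 < s" using pos x by (simp add: s_def)
  have f': "f' y = s * f y" if "y \<in> S" for y
    using le[OF x that] le[OF that x] pos(1)[OF x] by (simp add: s_def field_simps)
  have g': "g' y = g y / s" if "y \<in> S" for y
  proof -
    have "g' y = schroedinger_op \<mu>\<^sub>1 (q \<circ> prod.swap) f' y"
      using fg' that by (simp add: schroedinger_potentials_def)
    also have "schroedinger_op \<mu>\<^sub>1 (q \<circ> prod.swap) f' = schroedinger_op \<mu>\<^sub>1 (q \<circ> prod.swap) (\<lambda>y. s * f y)"
      by (rule schroedinger_op_cong[OF \<mu>(1) f'])
    also have "\<dots> y = g y / s"
      using fg that by (simp add: schroedinger_potentials_def schroedinger_op_scale)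
    finally show ?thesis .
  qed
  have "(\<integral>x. 1 / f' x \<partial>\<mu>\<^sub>1) = (\<integral>x. inverse s * (1 / f x) \<partial>\<mu>\<^sub>1)"
    using f' p1(3) s by (intro Bochner_Integration.integral_cong) (auto simp: field_simps)
  then have 1: "(\<integral>x. 1 / f' x \<partial>\<mu>\<^sub>1) = inverse s * (\<integral>x. 1 / f x \<partial>\<mu>\<^sub>1)"
    by (simp only: integral_mult_right_zero)
  have "(\<integral>y. 1 / g' y \<partial>\<mu>\<^sub>2) = (\<integral>x. s * (1 / g x) \<partial>\<mu>\<^sub>2)"
    using p2(3) by (intro Bochner_Integration.integral_cong) (simp_all add: g')
  then have 2: "(\<integral>y. 1 / g' y \<partial>\<mu>\<^sub>2) = s * (\<integral>y. 1 / g y \<partial>\<mu>\<^sub>2)"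
    by (simp only: integral_mult_right_zero)
  have "pos_cont S (\<lambda>x. 1 / f x)"
    using pc(1) by (intro pos_cont_divide) (auto simp: pos_cont_def)
  then have "0 < (\<integral>x. 1 / f x \<partial>\<mu>\<^sub>1)" by (rule pos_integral_cont[OF S \<mu>(1)])
  moreover have "inverse s * (\<integral>x. 1 / f x \<partial>\<mu>\<^sub>1) = s * (\<integral>x. 1 / f x \<partial>\<mu>\<^sub>1)"
    using 1 2 fg fg' by (simp add: schroedinger_potentials_def)
  ultimately have "inverse s = s" by simp
  then have "s * s = 1" using s by (metis less_irrefl right_inverse)
  then have "s = 1" using s by (metis abs_of_pos abs_1 abs_mult_self_eq mult.right_neutral power2_eq_iff_nonneg power2_eq_square less_imp_le zero_le_one)
  then show "f x = f' x" "g x = g' x" using f'[OF x] g'[OF x] by auto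
qed

text \<open>Fubini for the weight \<open>q (x, y) / (h x * k y)\<close>: integrating first over
  \<open>x\<close> gives 1 by the definition of \<open>k\<close>, integrating first over
  \<open>y\<close> gives \<open>lam\<close> by the eigenvalue equation. Both measures have mass one,
  so \<open>lam = 1\<close>.\<close>

lemma schroedinger_potentials_of_eigenfunction:
  assumes S: "compact S" and \<mu>: "\<mu>\<^sub>1 \<in> borel_probs S" "\<mu>\<^sub>2 \<in> borel_probs S" and q: "pos_cont (S \<times> S) q"
    and h: "pos_cont S h" and eig: "\<And>x. x \<in> S \<Longrightarrow> round_trip q \<mu>\<^sub>1 \<mu>\<^sub>2 h x = lam * h x"
  shows "\<exists>f g. schroedinger_potentials S q \<mu>\<^sub>1 \<mu>\<^sub>2 f g"
proof -
  note p1 = borel_probsD[OF \<mu>(1)] and p2 = borel_probsD[OF \<mu>(2)]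
  interpret P1: prob_space \<mu>\<^sub>1 by (rule p1)
  interpret P2: prob_space \<mu>\<^sub>2 by (rule p2)
  interpret P: pair_prob_space \<mu>\<^sub>1 \<mu>\<^sub>2 ..
  note q' = pos_cont_swap[OF q]
  define k where "k = schroedinger_op \<mu>\<^sub>1 (q \<circ> prod.swap) h"
  have k: "pos_cont S k" unfolding k_def by (rule pos_cont_schroedinger_op[OF S \<mu>(1) q' h])
  have hk: "\<And>x. x \<in> S \<Longrightarrow> 0 < h x" "\<And>x. x \<in> S \<Longrightarrow> 0 < k x"
    using h k by (auto simp: pos_cont_def)
  have Th: "schroedinger_op \<mu>\<^sub>2 q k x = lam * h x" if "x \<in> S" for x
    using eig[OF that] by (simp add: round_trip_def k_def)
  let ?w = "\<lambda>z. q z / k (snd z) / h (fst z)"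
  have "pos_cont (S \<times> S) (\<lambda>z. h (fst z))"
    using h unfolding pos_cont_def by (auto intro!: continuous_on_compose2[of S h] continuous_intros)
  from pos_cont_divide[OF continuous_on_kernel[OF q k] this]
  have wc: "continuous_on (S \<times> S) ?w" by (simp add: pos_cont_def)
  have "integrable (\<mu>\<^sub>1 \<Otimes>\<^sub>M \<mu>\<^sub>2) ?w"
    by (rule integrable_cont_pair[OF S P1.finite_measure_axioms p1(2) P2.finite_measure_axioms p2(2) wc])
  then have "integrable (\<mu>\<^sub>1 \<Otimes>\<^sub>M \<mu>\<^sub>2) (case_prod (\<lambda>x y. ?w (x, y)))"
    by (simp add: case_prod_unfold)
  from P.Fubini_integral[OF this]
  have F: "(\<integral>y. (\<integral>x. ?w (x, y) \<partial>\<mu>\<^sub>1) \<partial>\<mu>\<^sub>2) = (\<integral>x. (\<integral>y. ?w (x, y) \<partial>\<mu>\<^sub>2) \<partial>\<mu>\<^sub>1)" .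
  have "(\<integral>x. ?w (x, y) \<partial>\<mu>\<^sub>1) = 1" if y: "y \<in> S" for y
  proof -
    have "(\<integral>x. ?w (x, y) \<partial>\<mu>\<^sub>1) = (\<integral>x. (q \<circ> prod.swap) (y, x) / h x / k y \<partial>\<mu>\<^sub>1)"
      by (simp add: mult.commute)
    also have "\<dots> = k y / k y"
      unfolding integral_divide_zero by (simp only: k_def schroedinger_op_def)
    finally show ?thesis using hk(2)[OF y] by simp
  qed
  then have 1: "(\<integral>y. (\<integral>x. ?w (x, y) \<partial>\<mu>\<^sub>1) \<partial>\<mu>\<^sub>2) = (\<integral>y. 1 \<partial>\<mu>\<^sub>2)"
    using p2(3) by (intro Bochner_Integration.integral_cong) auto
  have "(\<integral>y. ?w (x, y) \<partial>\<mu>\<^sub>2) = lam" if x: "x \<in> S" for x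
  proof -
    have "(\<integral>y. ?w (x, y) \<partial>\<mu>\<^sub>2) = (\<integral>y. q (x, y) / k y / h x \<partial>\<mu>\<^sub>2)"
      by simp
    also have "\<dots> = lam * h x / h x"
      unfolding integral_divide_zero Th[OF x, symmetric] by (simp only: schroedinger_op_def)
    finally show ?thesis using hk(1)[OF x] by simp
  qed
  then have 2: "(\<integral>x. (\<integral>y. ?w (x, y) \<partial>\<mu>\<^sub>2) \<partial>\<mu>\<^sub>1) = (\<integral>x. lam \<partial>\<mu>\<^sub>1)"
    using p1(3) by (intro Bochner_Integration.integral_cong) auto
  have lam: "lam = 1"
    using F unfolding 1 2 by (simp add: P1.prob_space P2.prob_space)
  let ?a = "\<integral>x. 1 / h x \<partial>\<mu>\<^sub>1" and ?b = "\<integral>x. 1 / k x \<partial>\<mu>\<^sub>2"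
  have one: "pos_cont S (\<lambda>_. 1)" by (simp add: pos_cont_def)
  have ab: "0 < ?a" "0 < ?b"
    by (rule pos_integral_cont[OF S \<mu>(1) pos_cont_divide[OF one h]]
        pos_integral_cont[OF S \<mu>(2) pos_cont_divide[OF one k]])+
  \<comment> \<open>Scaling \<open>h\<close> by \<open>s\<close> and \<open>k\<close> by its inverse
    turns the masses \<open>?a\<close> and \<open>?b\<close> into \<open>?a / s\<close> and
    \<open>s * ?b\<close>; they agree exactly when the square of \<open>s\<close> is
    \<open>?a / ?b\<close>.\<close>
  define s where "s = sqrt (?a / ?b)"
  have s: "0 < s" "s * s = ?a / ?b" using ab by (auto simp: s_def)
  have "schroedinger_potentials S q \<mu>\<^sub>1 \<mu>\<^sub>2 (\<lambda>x. s * h x) (\<lambda>y. inverse s * k y)"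
    unfolding schroedinger_potentials_def
  proof (intro conjI ballI)
    show "pos_cont S (\<lambda>x. s * h x)" "pos_cont S (\<lambda>y. inverse s * k y)"
      using h k s by (auto simp: pos_cont_def intro!: continuous_intros)
    show "s * h x = schroedinger_op \<mu>\<^sub>2 q (\<lambda>y. inverse s * k y) x" if "x \<in> S" for x
      using Th[OF that] lam by (simp add: schroedinger_op_scale divide_inverse mult.commute)
    show "inverse s * k y = schroedinger_op \<mu>\<^sub>1 (q \<circ> prod.swap) (\<lambda>x. s * h x) y" if "y \<in> S" for y
      by (simp add: schroedinger_op_scale k_def divide_inverse mult.commute)
    have "(\<integral>x. 1 / (s * h x) \<partial>\<mu>\<^sub>1) = (\<integral>x. inverse s * (1 / h x) \<partial>\<mu>\<^sub>1)"
      by (simp add: field_simps)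
    also have "\<dots> = inverse s * ?a" by (simp only: integral_mult_right_zero)
    also have "\<dots> = s * ?b" using s ab by (simp add: field_simps)
    also have "\<dots> = (\<integral>y. s * (1 / k y) \<partial>\<mu>\<^sub>2)" by (simp only: integral_mult_right_zero)
    also have "\<dots> = (\<integral>y. 1 / (inverse s * k y) \<partial>\<mu>\<^sub>2)" by (simp add: field_simps)
    finally show "(\<integral>x. 1 / (s * h x) \<partial>\<mu>\<^sub>1) = (\<integral>y. 1 / (inverse s * k y) \<partial>\<mu>\<^sub>2)" .
  qed
  then show ?thesis by blast
qed

text \<open>A Harnack-type inequality: \<open>x\<close> enters only through the kernel, whose values
  differ by a factor of at most \<open>M / m\<close>. The constant does not depend on
  \<open>h\<close>, so it bounds all iterates at once.\<close>

lemma schroedinger_op_le: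
  assumes S: "compact S" and \<mu>: "\<mu> \<in> borel_probs S" and k: "pos_cont (S \<times> S) k"
    and m: "0 < m" "\<And>z. z \<in> S \<times> S \<Longrightarrow> m \<le> k z \<and> k z \<le> M"
    and h: "pos_cont S h" and x: "x \<in> S" "x' \<in> S"
  shows "schroedinger_op \<mu> k h x \<le> M / m * schroedinger_op \<mu> k h x'"
proof -
  note int = integrable_schroedinger_op[OF S \<mu> k h]
  have "(\<integral>y. k (x, y) / h y \<partial>\<mu>) \<le> (\<integral>y. M / m * (k (x', y) / h y) \<partial>\<mu>)"
  proof (rule integral_mono)
    fix y assume "y \<in> space \<mu>"
    then have y: "y \<in> S" using borel_probsD[OF \<mu>] by simp
    have "k (x, y) \<le> M / m * m" using m(1) m(2)[of "(x, y)"] x y by auto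
    also have "\<dots> \<le> M / m * k (x', y)"
      using m(1) m(2)[of "(x, y)"] m(2)[of "(x', y)"] x y by (intro mult_left_mono) auto
    finally have "k (x, y) / h y \<le> M / m * k (x', y) / h y"
      using h y by (intro divide_right_mono) (auto simp: pos_cont_def less_imp_le)
    then show "k (x, y) / h y \<le> M / m * (k (x', y) / h y)" by simp
  qed (intro integrable_mult_right int x)+
  then show ?thesis by (simp add: schroedinger_op_def del: times_divide_eq_right)
qed

lemma ex_schroedinger_potentials:
  assumes S: "compact S" and \<mu>: "\<mu>\<^sub>1 \<in> borel_probs S" "\<mu>\<^sub>2 \<in> borel_probs S" and q: "pos_cont (S \<times> S) q"
  shows "\<exists>f g. schroedinger_potentials S q \<mu>\<^sub>1 \<mu>\<^sub>2 f g"
proof -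
  note p1 = borel_probsD[OF \<mu>(1)] and p2 = borel_probsD[OF \<mu>(2)]
  obtain x0 where x0: "x0 \<in> S" using p1(4) by blast
  obtain m M where m: "0 < m" "0 < M" "\<And>z. z \<in> S \<times> S \<Longrightarrow> m \<le> q z \<and> q z \<le> M"
    using pos_cont_bounds[OF compact_Times[OF S S] q] by metis
  let ?T = "round_trip q \<mu>\<^sub>1 \<mu>\<^sub>2"
  define F where "F n = (?T ^^ n) (\<lambda>_. 1)" for n
  have F_Suc: "F (Suc n) = ?T (F n)" for n by (simp add: F_def)
  have Fc: "pos_cont S (F n)" for n
  proof (induction n)
    case 0 show ?case by (simp add: F_def pos_cont_def)
  next
    case (Suc n) then show ?case unfolding F_Suc by (rule pos_cont_round_trip[OF S \<mu> q])
  qed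
  have Fp: "0 < F n x" if "x \<in> S" for n x using Fc that by (auto simp: pos_cont_def)
  have mM: "m \<le> M" using m(3)[of "(x0, x0)"] x0 by auto
  have F_le: "F n x \<le> M / m * F n y" if xy: "x \<in> S" "y \<in> S" for n x y
  proof (cases n)
    case 0 then show ?thesis using mM m(1) by (simp add: F_def)
  next
    case (Suc k)
    show ?thesis unfolding Suc F_Suc round_trip_def
      by (rule schroedinger_op_le[OF S \<mu>(2) q m(1,3) pos_cont_schroedinger_op[OF S \<mu>(1) pos_cont_swap[OF q] Fc] xy])
  qed
  \<comment> \<open>The eigenvalue is not known at this point, so the iterates are compared only
    after division by their value at \<open>x0\<close>.\<close>
  define G where "G n x = F n x / F n x0" for n x
  have Gc: "pos_cont S (G n)" for n
    using Fc[of n] Fp[OF x0, of n] by (auto simp: pos_cont_def G_def intro!: continuous_intros)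
  have Gb: "G n x \<le> M / m" "m / M \<le> G n x" if "x \<in> S" for n x
    using F_le[OF that x0, of n] F_le[OF x0 that, of n] Fp[OF x0, of n] m(1,2)
    by (simp_all add: G_def field_simps)
  define \<rho> where "\<rho> = 1 - (m / M)\<^sup>2"
  have "0 \<le> m / M" "m / M \<le> 1" using m mM by auto
  then have "(m / M)\<^sup>2 \<le> 1" by (rule power_le_one)
  then have \<rho>: "0 \<le> \<rho>" "\<rho> < 1" using m(1,2) by (auto simp: \<rho>_def)
  obtain r0 where r0: "ratio_le S r0 (F (Suc 0)) (F 0)" using ex_ratio_le[OF S Fc Fc] by blast
  have ratio: "ratio_le S (1 + \<rho> ^ n * (r0 - 1)) (F (Suc n)) (F n)" for n
  proof (induction n)
    case 0 then show ?case using r0 by simp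
  next
    case (Suc n)
    from ratio_le_round_trip[OF S \<mu> q m(1,3) Fc Fc this] show ?case
      unfolding F_Suc[of "Suc n"] F_Suc[of n] \<rho>_def
      by (simp add: algebra_simps)
  qed
  \<comment> \<open>Both functions equal 1 at \<open>x0\<close>, so the ratio bound for the points
    \<open>x\<close> and \<open>x0\<close> is a relative error bound at \<open>x\<close>; the upper
    bound on \<open>G\<close> makes it absolute.\<close>
  have step: "norm (G (Suc n) x - G n x) \<le> \<rho> ^ n * ((r0 - 1) * (M / m))" if x: "x \<in> S" for n x
  proof -
    define r where "r = 1 + \<rho> ^ n * (r0 - 1)"
    note rat = ratio[of n, folded r_def]
    have r: "1 \<le> r" by (rule ratio_le_ge_1[OF rat p1(4) Fp Fp])
    have quot: "a / b \<le> t * (c / d)" if "a * d \<le> t * (b * c)" "0 < b" "0 < d" for a b c d t :: real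
      using that by (simp add: field_simps)
    have "G (Suc n) x \<le> r * G n x"
      unfolding G_def by (rule quot[OF ratio_leD[OF rat x x0] Fp[OF x0] Fp[OF x0]])
    moreover have "G n x \<le> r * G (Suc n) x"
      unfolding G_def by (rule quot[OF ratio_leD[OF ratio_le_sym[OF rat] x x0] Fp[OF x0] Fp[OF x0]])
    moreover have "(r - 1) * G k x \<le> (r - 1) * (M / m)" for k
      using r by (intro mult_left_mono Gb(1)[OF x]) simp
    then have "r * G k x - G k x \<le> (r - 1) * (M / m)" for k by (simp only: left_diff_distrib mult_1)
    note this[of n] this[of "Suc n"]
    ultimately have "\<bar>G (Suc n) x - G n x\<bar> \<le> (r - 1) * (M / m)"
      by linarith
    then show ?thesis by (simp add: r_def mult.assoc)
  qed
  \<comment> \<open>The limit is written as a telescoping series starting at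
    \<open>G 0 x = 1\<close>, so that geometric decay of the increments gives uniform
    convergence.\<close>
  define L where "L x = 1 + (\<Sum>n. G (Suc n) x - G n x)" for x
  have "summable (\<lambda>n. \<rho> ^ n * ((r0 - 1) * (M / m)))"
    by (rule summable_mult2[OF summable_geometric]) (use \<rho> in simp)
  then have "uniform_limit S (\<lambda>n x. \<Sum>i<n. G (Suc i) x - G i x) (\<lambda>x. \<Sum>n. G (Suc n) x - G n x) sequentially"
    by (rule Weierstrass_m_test[rotated]) (rule step)
  then have "uniform_limit S (\<lambda>n x. 1 + (\<Sum>i<n. G (Suc i) x - G i x)) L sequentially"
    unfolding L_def by (intro uniform_limit_intros)
  moreover have "1 + (\<Sum>i<n. G (Suc i) x - G i x) = G n x" for n x
    using sum_lessThan_telescope[of "\<lambda>i. G i x" n] by (simp add: G_def F_def)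
  ultimately have lim: "uniform_limit S G L sequentially" by simp
  have limx: "(\<lambda>n. G n x) \<longlonglongrightarrow> L x" if "x \<in> S" for x
    by (rule tendsto_uniform_limitI[OF lim that])
  have "m / M \<le> L x" if "x \<in> S" for x
    by (rule tendsto_lowerbound[OF limx[OF that]]) (use Gb(2)[OF that] in auto)
  then have "0 < L x" if "x \<in> S" for x
    using that m(1,2) by (smt (verit) divide_pos_pos)
  moreover have "continuous_on S L"
    by (rule uniform_limit_theorem[OF _ lim]) (use Gc in \<open>auto simp: pos_cont_def\<close>)
  ultimately have L: "pos_cont S L" by (simp add: pos_cont_def)
  have limT: "uniform_limit S (\<lambda>n. ?T (G n)) (?T L) sequentially"
    unfolding round_trip_def
    by (intro uniform_limit_schroedinger_op[OF S] always_eventually allI norm_conv_const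
        uniform_limit_const pos_cont_schroedinger_op[OF S] pos_cont_swap \<mu> q L Gc lim)
  \<comment> \<open>Homogeneity of the cycle: applied to \<open>G n\<close> it gives a multiple of
    \<open>G (Suc n)\<close>, and the multiple is read off at \<open>x0\<close>. In the limit this
    becomes an eigenvalue equation with eigenvalue \<open>?T L x0\<close>.\<close>
  have TG: "?T (G n) x = G (Suc n) x * ?T (G n) x0" if "x \<in> S" for n x
  proof -
    have "G n = (\<lambda>x. inverse (F n x0) * F n x)" by (simp add: G_def fun_eq_iff divide_inverse mult.commute)
    then have "?T (G n) y = inverse (F n x0) * F (Suc n) y" for y
      by (simp add: round_trip_scale F_Suc)
    then show ?thesis using Fp[OF x0, of n] Fp[OF x0, of "Suc n"] by (simp add: G_def)
  qed
  have "?T L x = ?T L x0 * L x" if x: "x \<in> S" for x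
  proof (rule LIMSEQ_unique)
    show "(\<lambda>n. ?T (G n) x) \<longlonglongrightarrow> ?T L x"
      by (rule tendsto_uniform_limitI[OF limT x])
    have "(\<lambda>n. G (Suc n) x * ?T (G n) x0) \<longlonglongrightarrow> L x * ?T L x0"
      by (intro tendsto_mult tendsto_uniform_limitI[OF limT x0] LIMSEQ_Suc limx x)
    then show "(\<lambda>n. ?T (G n) x) \<longlonglongrightarrow> ?T L x0 * L x"
      unfolding TG[OF x] by (simp only: mult.commute)
  qed
  from schroedinger_potentials_of_eigenfunction[OF S \<mu> q L this] show ?thesis .
qed

subsection \<open>Potentials and the normalized pair\<close>

text \<open>The definition asks only for sigma-finiteness. The kernel integral lies between
  \<open>m\<close> and \<open>B\<close> times the mass of \<open>N\<close>; if that mass were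
  infinite or zero, the kernel integral would be constantly infinite or zero and the density could
  not have total mass 1, whatever the mass of \<open>M\<close>.\<close>

lemma finite_of_schroedinger_density:
  fixes M N :: "'a::metric_space measure"
  assumes S: "compact S" and M: "sets M = sets (restrict_space borel S)"
    and N: "sets N = sets (restrict_space borel S)" "sigma_finite_measure N"
    and k: "pos_cont (S \<times> S) k"
    and prob: "prob_space (density M (\<lambda>x. \<integral>\<^sup>+y. ennreal (k (x, y)) \<partial>N))"
  shows "finite_measure N" "0 < measure N S"
proof -
  have sp: "space M = S" "space N = S"
    using sets_eq_imp_space_eq[OF M] sets_eq_imp_space_eq[OF N(1)] by (auto simp: space_restrict_space)
  let ?F = "\<lambda>x. \<integral>\<^sup>+y. ennreal (k (x, y)) \<partial>N"
  let ?e = "emeasure N S"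
  obtain m B where m: "0 < m" "0 < B" "\<And>z. z \<in> S \<times> S \<Longrightarrow> m \<le> k z \<and> k z \<le> B"
    using pos_cont_bounds[OF compact_Times[OF S S] k] by metis
  have "k \<in> borel_measurable (M \<Otimes>\<^sub>M N)"
    using k by (intro borel_measurable_cont_pair[OF S M N(1)]) (simp add: pos_cont_def)
  then have Fm: "?F \<in> borel_measurable M"
    by (intro sigma_finite_measure.borel_measurable_nn_integral[OF N(2)]) (simp add: case_prod_unfold)
  have "emeasure (density M ?F) S = 1"
    using prob_space.emeasure_space_1[OF prob] sp by simp
  moreover have "S \<in> sets M" using sets.top[of M] sp by simp
  moreover have "(\<integral>\<^sup>+x. ?F x * indicator S x \<partial>M) = (\<integral>\<^sup>+x. ?F x \<partial>M)"
    using sp by (intro nn_integral_cong) auto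
  ultimately have one: "(\<integral>\<^sup>+x. ?F x \<partial>M) = 1"
    using Fm by (simp add: emeasure_density)
  have lower: "ennreal m * ?e \<le> ?F x" if "x \<in> S" for x
  proof -
    have "ennreal m * ?e = (\<integral>\<^sup>+y. ennreal m \<partial>N)" using sp by simp
    also have "\<dots> \<le> ?F x" using m that sp by (intro nn_integral_mono ennreal_leI) auto
    finally show ?thesis .
  qed
  have upper: "?F x \<le> ennreal B * ?e" if "x \<in> S" for x
  proof -
    have "?F x \<le> (\<integral>\<^sup>+y. ennreal B \<partial>N)" using m that sp by (intro nn_integral_mono ennreal_leI) auto
    also have "\<dots> = ennreal B * ?e" using sp by simp
    finally show ?thesis .
  qed
  have "?e \<noteq> \<infinity>"
  proof
    assume e: "?e = \<infinity>"
    have "?F x = \<infinity>" if "x \<in> S" for x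
      using lower[OF that] m(1) unfolding e by (simp add: ennreal_mult_top top_unique)
    then have "(\<integral>\<^sup>+x. ?F x \<partial>M) = (\<integral>\<^sup>+x. \<infinity> \<partial>M)" using sp by (intro nn_integral_cong) auto
    then show False using one by (simp add: ennreal_top_mult split: if_splits)
  qed
  then show fin: "finite_measure N" using sp by (intro finite_measureI) simp
  have "?e \<noteq> 0"
  proof
    assume e: "?e = 0"
    have "(\<integral>\<^sup>+x. ?F x \<partial>M) = (\<integral>\<^sup>+x. 0 \<partial>M)"
      using upper sp unfolding e by (intro nn_integral_cong) auto
    then show False using one by simp
  qed
  then show "0 < measure N S"
    using \<open>?e \<noteq> \<infinity>\<close> by (simp add: measure_def enn2real_positive_iff less_top zero_less_iff_neq_zero)
qed

lemma nn_integral_kernel_finite: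
  fixes N :: "'a::metric_space measure"
  assumes S: "compact S" and N: "sets N = sets (restrict_space borel S)" "finite_measure N"
    and k: "pos_cont (S \<times> S) k" and x: "x \<in> S"
  shows "(\<integral>\<^sup>+y. ennreal (k (x, y)) \<partial>N) = ennreal (\<integral>y. k (x, y) \<partial>N)"
proof (rule nn_integral_eq_integral)
  have sp: "space N = S"
    using sets_eq_imp_space_eq[OF N(1)] by (auto simp: space_restrict_space)
  note kx = pos_cont_section[OF k x]
  show "integrable N (\<lambda>y. k (x, y))"
    using kx by (intro integrable_cont_compact[OF S N(2,1)]) (simp add: pos_cont_def)
  show "AE y in N. 0 \<le> k (x, y)"
    using kx sp by (intro AE_I2) (auto simp: pos_cont_def less_imp_le)
qed

lemma pos_cont_integral_kernel:
  fixes N :: "'a::metric_space measure"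
  assumes S: "compact S" and N: "sets N = sets (restrict_space borel S)" "finite_measure N" "0 < measure N S"
    and k: "pos_cont (S \<times> S) k"
  shows "pos_cont S (\<lambda>x. \<integral>y. k (x, y) \<partial>N)"
  unfolding pos_cont_def
proof (intro conjI ballI)
  show "continuous_on S (\<lambda>x. \<integral>y. k (x, y) \<partial>N)"
    using k by (intro continuous_on_integral_param[OF S N(2,1)]) (simp add: pos_cont_def)
  fix x assume x: "x \<in> S"
  have sp: "space N = S"
    using sets_eq_imp_space_eq[OF N(1)] by (auto simp: space_restrict_space)
  interpret finite_measure N by (rule N)
  obtain m B where m: "0 < m" "0 < B" "\<And>z. z \<in> S \<times> S \<Longrightarrow> m \<le> k z \<and> k z \<le> B"
    using pos_cont_bounds[OF compact_Times[OF S S] k] by metis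
  have "m * measure N S = (\<integral>y. m \<partial>N)" using sp by simp
  also have "\<dots> \<le> (\<integral>y. k (x, y) \<partial>N)"
    using m(3) x sp pos_cont_section[OF k x]
    by (intro integral_mono integrable_cont_compact[OF S N(2,1)]) (auto simp: pos_cont_def)
  finally show "0 < (\<integral>y. k (x, y) \<partial>N)" using m N(3) by (smt (verit) mult_pos_pos)
qed

lemma density_inverse_density:
  fixes M :: "'a::metric_space measure"
  assumes M: "sets M = sets (restrict_space borel S)" and f: "pos_cont S f" and g: "pos_cont S g"
    and fg: "\<And>x. x \<in> S \<Longrightarrow> f x * g x = 1"
  shows "density (density M (\<lambda>x. ennreal (f x))) (\<lambda>x. ennreal (g x)) = M"
proof -
  have sp: "space M = S"
    using sets_eq_imp_space_eq[OF M] by (auto simp: space_restrict_space)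
  have fm: "(\<lambda>x. ennreal (f x)) \<in> borel_measurable M" and gm: "(\<lambda>x. ennreal (g x)) \<in> borel_measurable M"
    using borel_measurable_cont_restrict[OF M] f g by (auto simp: pos_cont_def)
  have "density (density M (\<lambda>x. ennreal (f x))) (\<lambda>x. ennreal (g x)) = density M (\<lambda>x. ennreal (f x) * ennreal (g x))"
    by (rule density_density_eq[OF fm gm])
  also have "\<dots> = density M (\<lambda>_. 1)"
  proof (rule density_cong)
    have "ennreal (f x) * ennreal (g x) = 1" if "x \<in> S" for x
      using fg[OF that] f that by (simp add: ennreal_mult'[symmetric] pos_cont_def less_imp_le)
    then show "AE x in M. ennreal (f x) * ennreal (g x) = 1" using sp by (intro AE_I2) auto
  qed (use fm gm in auto)
  finally show ?thesis by (simp add: density_1)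
qed

lemma density_cong_space:
  assumes "\<And>x. x \<in> space M \<Longrightarrow> f x = g x"
  shows "density M f = density M g"
proof -
  have "(\<integral>\<^sup>+x. f x * indicator A x \<partial>M) = (\<integral>\<^sup>+x. g x * indicator A x \<partial>M)" for A
    using assms by (intro nn_integral_cong) simp
  then show ?thesis by (simp add: density_def)
qed

lemma pos_cont_inverse: "pos_cont S f \<Longrightarrow> pos_cont S (\<lambda>x. 1 / f x)"
  by (rule pos_cont_divide) (auto simp: pos_cont_def)

lemma finite_density_pos_cont:
  assumes S: "compact S" and \<mu>: "\<mu> \<in> borel_probs S" and f: "pos_cont S f"
  shows "emeasure (density \<mu> (\<lambda>x. ennreal (f x))) S = ennreal (\<integral>x. f x \<partial>\<mu>)"
    and "finite_measure (density \<mu> (\<lambda>x. ennreal (f x)))"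
proof -
  note p = borel_probsD[OF \<mu>]
  have fm: "(\<lambda>x. ennreal (f x)) \<in> borel_measurable \<mu>"
    using borel_measurable_cont_restrict[OF p(2)] f by (auto simp: pos_cont_def)
  have "S \<in> sets \<mu>" using sets.top[of \<mu>] p(3) by simp
  then have "emeasure (density \<mu> (\<lambda>x. ennreal (f x))) S = (\<integral>\<^sup>+x. ennreal (f x) * indicator S x \<partial>\<mu>)"
    using fm by (rule emeasure_density[rotated])
  also have "\<dots> = (\<integral>\<^sup>+x. ennreal (f x) \<partial>\<mu>)"
    using p(3) by (intro nn_integral_cong) auto
  also have "\<dots> = ennreal (\<integral>x. f x \<partial>\<mu>)"
  proof (rule nn_integral_eq_integral)
    show "integrable \<mu> f"
      using f p by (intro integrable_cont_compact[OF S]) (auto simp: pos_cont_def prob_space.finite_measure)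
    show "AE x in \<mu>. 0 \<le> f x" using f p(3) by (intro AE_I2) (auto simp: pos_cont_def less_imp_le)
  qed
  finally show *: "emeasure (density \<mu> (\<lambda>x. ennreal (f x))) S = ennreal (\<integral>x. f x \<partial>\<mu>)" .
  show "finite_measure (density \<mu> (\<lambda>x. ennreal (f x)))"
    by (rule finite_measureI) (use * p(3) in simp)
qed

lemma integral_density_pos_cont:
  fixes \<phi> :: "'a::metric_space \<Rightarrow> real"
  assumes \<mu>: "\<mu> \<in> borel_probs S" and f: "pos_cont S f" and \<phi>: "continuous_on S \<phi>"
  shows "(\<integral>x. \<phi> x \<partial>density \<mu> (\<lambda>x. ennreal (f x))) = (\<integral>x. f x * \<phi> x \<partial>\<mu>)"
proof -
  note p = borel_probsD[OF \<mu>]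
  have "AE x in \<mu>. 0 \<le> f x" using f p(3) by (intro AE_I2) (auto simp: pos_cont_def less_imp_le)
  then show ?thesis
    using borel_measurable_cont_restrict[OF p(2)] f \<phi>
    by (subst integral_density) (auto simp: pos_cont_def)
qed

text \<open>One of the two equations, for a general kernel: integrating \<open>k (x, y)\<close>
  against \<open>\<mu>'\<close> divided by \<open>g\<close> returns \<open>f x\<close>, which
  cancels the density \<open>1 / f\<close>. The swapped kernel yields the other equation.\<close>

lemma schroedinger_density_of_potential:
  assumes S: "compact S" and \<mu>: "\<mu> \<in> borel_probs S" and \<mu>': "\<mu>' \<in> borel_probs S"
    and k: "pos_cont (S \<times> S) k" and f: "pos_cont S f" and g: "pos_cont S g"
    and fg: "\<And>x. x \<in> S \<Longrightarrow> f x = schroedinger_op \<mu>' k g x"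
  shows "\<mu> = density (density \<mu> (\<lambda>x. ennreal (1 / f x)))
           (\<lambda>x. \<integral>\<^sup>+y. ennreal (k (x, y)) \<partial>density \<mu>' (\<lambda>y. ennreal (1 / g y)))"
proof -
  note p = borel_probsD[OF \<mu>] and p' = borel_probsD[OF \<mu>']
  have "(\<integral>\<^sup>+y. ennreal (k (x, y)) \<partial>density \<mu>' (\<lambda>y. ennreal (1 / g y))) = ennreal (f x)" if x: "x \<in> S" for x
  proof -
    have "(\<integral>\<^sup>+y. ennreal (k (x, y)) \<partial>density \<mu>' (\<lambda>y. ennreal (1 / g y)))
        = ennreal (\<integral>y. k (x, y) \<partial>density \<mu>' (\<lambda>y. ennreal (1 / g y)))"
      using p' finite_density_pos_cont(2)[OF S \<mu>' pos_cont_inverse[OF g]]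
      by (intro nn_integral_kernel_finite[OF S _ _ k x]) auto
    also have "(\<integral>y. k (x, y) \<partial>density \<mu>' (\<lambda>y. ennreal (1 / g y))) = (\<integral>y. 1 / g y * k (x, y) \<partial>\<mu>')"
      using pos_cont_section[OF k x]
      by (intro integral_density_pos_cont[OF \<mu>' pos_cont_inverse[OF g]]) (simp add: pos_cont_def)
    also have "\<dots> = f x" using fg[OF x] by (simp add: schroedinger_op_def)
    finally show ?thesis .
  qed
  then have "density (density \<mu> (\<lambda>x. ennreal (1 / f x)))
           (\<lambda>x. \<integral>\<^sup>+y. ennreal (k (x, y)) \<partial>density \<mu>' (\<lambda>y. ennreal (1 / g y)))
     = density (density \<mu> (\<lambda>x. ennreal (1 / f x))) (\<lambda>x. ennreal (f x))"
    using p(3) by (intro density_cong_space) simp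
  also have "\<dots> = \<mu>"
    using f by (intro density_inverse_density[OF p(2) pos_cont_inverse[OF f] f]) (force simp: pos_cont_def)
  finally show ?thesis by simp
qed

lemma schroedinger_solution_of_potentials:
  assumes S: "compact S" and \<mu>: "\<mu>\<^sub>1 \<in> borel_probs S" "\<mu>\<^sub>2 \<in> borel_probs S" and q: "pos_cont (S \<times> S) q"
    and fg: "schroedinger_potentials S q \<mu>\<^sub>1 \<mu>\<^sub>2 f g"
  shows "schroedinger_solution S q \<mu>\<^sub>1 \<mu>\<^sub>2 (density \<mu>\<^sub>1 (\<lambda>x. ennreal (1 / f x))) (density \<mu>\<^sub>2 (\<lambda>x. ennreal (1 / g x)))"
    and "emeasure (density \<mu>\<^sub>1 (\<lambda>x. ennreal (1 / f x))) S = emeasure (density \<mu>\<^sub>2 (\<lambda>x. ennreal (1 / g x))) S"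
proof -
  have f: "pos_cont S f" and g: "pos_cont S g"
    and fe: "\<And>x. x \<in> S \<Longrightarrow> f x = schroedinger_op \<mu>\<^sub>2 q g x"
    and ge: "\<And>y. y \<in> S \<Longrightarrow> g y = schroedinger_op \<mu>\<^sub>1 (q \<circ> prod.swap) f y"
    and norm: "(\<integral>x. 1 / f x \<partial>\<mu>\<^sub>1) = (\<integral>y. 1 / g y \<partial>\<mu>\<^sub>2)"
    using fg by (auto simp: schroedinger_potentials_def)
  note d1 = finite_density_pos_cont[OF S \<mu>(1) pos_cont_inverse[OF f]]
  note d2 = finite_density_pos_cont[OF S \<mu>(2) pos_cont_inverse[OF g]]
  show "emeasure (density \<mu>\<^sub>1 (\<lambda>x. ennreal (1 / f x))) S = emeasure (density \<mu>\<^sub>2 (\<lambda>x. ennreal (1 / g x))) S"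
    unfolding d1 d2 norm ..
  show "schroedinger_solution S q \<mu>\<^sub>1 \<mu>\<^sub>2 (density \<mu>\<^sub>1 (\<lambda>x. ennreal (1 / f x))) (density \<mu>\<^sub>2 (\<lambda>x. ennreal (1 / g x)))"
    unfolding schroedinger_solution_def
    using schroedinger_density_of_potential[OF S \<mu> q f g fe]
      schroedinger_density_of_potential[OF S \<mu>(2,1) pos_cont_swap[OF q] g f ge]
      borel_probsD(2)[OF \<mu>(1)] borel_probsD(2)[OF \<mu>(2)]
      finite_measure.axioms(1)[OF d1(2)] finite_measure.axioms(1)[OF d2(2)]
    by simp
qed

text \<open>The same equation read backwards: for finite nonzero \<open>N\<close> the kernel
  integral is a positive continuous function, so its density can be divided out.\<close>

lemma potential_of_schroedinger_density:
  fixes M N :: "'a::metric_space measure"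
  assumes S: "compact S" and \<mu>: "\<mu> \<in> borel_probs S"
    and M: "sets M = sets (restrict_space borel S)"
    and N: "sets N = sets (restrict_space borel S)" "finite_measure N" "0 < measure N S"
    and k: "pos_cont (S \<times> S) k"
    and eq: "\<mu> = density M (\<lambda>x. \<integral>\<^sup>+y. ennreal (k (x, y)) \<partial>N)"
  shows "M = density \<mu> (\<lambda>x. ennreal (1 / (\<integral>y. k (x, y) \<partial>N)))"
proof -
  have sp: "space M = S"
    using sets_eq_imp_space_eq[OF M] by (auto simp: space_restrict_space)
  note f = pos_cont_integral_kernel[OF S N k]
  have "\<mu> = density M (\<lambda>x. ennreal (\<integral>y. k (x, y) \<partial>N))"
    unfolding eq using nn_integral_kernel_finite[OF S N(1,2) k] sp by (intro density_cong_space) simp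
  then show ?thesis
    using density_inverse_density[OF M f pos_cont_inverse[OF f]] f by (force simp: pos_cont_def)
qed

text \<open>An arbitrary normalized solution is shown to come from potentials, its own kernel
  integrals. Uniqueness of the normalized pair is thereby reduced to uniqueness of
  potentials.\<close>

lemma potentials_of_schroedinger_solution:
  assumes S: "compact S" and \<mu>: "\<mu>\<^sub>1 \<in> borel_probs S" "\<mu>\<^sub>2 \<in> borel_probs S" and q: "pos_cont (S \<times> S) q"
    and sol: "schroedinger_solution S q \<mu>\<^sub>1 \<mu>\<^sub>2 \<nu>\<^sub>1 \<nu>\<^sub>2" and norm: "emeasure \<nu>\<^sub>1 S = emeasure \<nu>\<^sub>2 S"
  obtains f g where "schroedinger_potentials S q \<mu>\<^sub>1 \<mu>\<^sub>2 f g"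
    "\<nu>\<^sub>1 = density \<mu>\<^sub>1 (\<lambda>x. ennreal (1 / f x))" "\<nu>\<^sub>2 = density \<mu>\<^sub>2 (\<lambda>x. ennreal (1 / g x))"
proof -
  note q' = pos_cont_swap[OF q]
  have s1: "sets \<nu>\<^sub>1 = sets (restrict_space borel S)" "sigma_finite_measure \<nu>\<^sub>1"
    and s2: "sets \<nu>\<^sub>2 = sets (restrict_space borel S)" "sigma_finite_measure \<nu>\<^sub>2"
    and e1: "\<mu>\<^sub>1 = density \<nu>\<^sub>1 (\<lambda>x. \<integral>\<^sup>+y. ennreal (q (x, y)) \<partial>\<nu>\<^sub>2)"
    and e2: "\<mu>\<^sub>2 = density \<nu>\<^sub>2 (\<lambda>y. \<integral>\<^sup>+x. ennreal ((q \<circ> prod.swap) (y, x)) \<partial>\<nu>\<^sub>1)"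
    using sol by (auto simp: schroedinger_solution_def)
  have n2: "finite_measure \<nu>\<^sub>2" "0 < measure \<nu>\<^sub>2 S"
    using finite_of_schroedinger_density[OF S s1(1) s2 q] e1 borel_probsD(1)[OF \<mu>(1)] by auto
  have n1: "finite_measure \<nu>\<^sub>1" "0 < measure \<nu>\<^sub>1 S"
    using finite_of_schroedinger_density[OF S s2(1) s1 q'] e2 borel_probsD(1)[OF \<mu>(2)] by auto
  define f where "f x = (\<integral>y. q (x, y) \<partial>\<nu>\<^sub>2)" for x
  define g where "g y = (\<integral>x. (q \<circ> prod.swap) (y, x) \<partial>\<nu>\<^sub>1)" for y
  have f: "pos_cont S f" unfolding f_def[abs_def] by (rule pos_cont_integral_kernel[OF S s2(1) n2 q])
  have g: "pos_cont S g" unfolding g_def[abs_def] by (rule pos_cont_integral_kernel[OF S s1(1) n1 q'])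
  have d1: "\<nu>\<^sub>1 = density \<mu>\<^sub>1 (\<lambda>x. ennreal (1 / f x))"
    unfolding f_def by (rule potential_of_schroedinger_density[OF S \<mu>(1) s1(1) s2(1) n2 q e1])
  have d2: "\<nu>\<^sub>2 = density \<mu>\<^sub>2 (\<lambda>x. ennreal (1 / g x))"
    unfolding g_def by (rule potential_of_schroedinger_density[OF S \<mu>(2) s2(1) s1(1) n1 q' e2])
  have "schroedinger_potentials S q \<mu>\<^sub>1 \<mu>\<^sub>2 f g"
    unfolding schroedinger_potentials_def
  proof (intro conjI ballI f g)
    show "f x = schroedinger_op \<mu>\<^sub>2 q g x" if x: "x \<in> S" for x
      using integral_density_pos_cont[OF \<mu>(2) pos_cont_inverse[OF g], of "\<lambda>y. q (x, y)"] pos_cont_section[OF q x]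
      unfolding d2[symmetric] by (simp add: f_def schroedinger_op_def pos_cont_def)
    show "g y = schroedinger_op \<mu>\<^sub>1 (q \<circ> prod.swap) f y" if y: "y \<in> S" for y
      using integral_density_pos_cont[OF \<mu>(1) pos_cont_inverse[OF f], of "\<lambda>x. (q \<circ> prod.swap) (y, x)"]
        pos_cont_section[OF q' y]
      unfolding d1[symmetric] by (simp add: g_def schroedinger_op_def pos_cont_def)
    have 1: "emeasure \<nu>\<^sub>1 S = ennreal (\<integral>x. 1 / f x \<partial>\<mu>\<^sub>1)"
      using finite_density_pos_cont(1)[OF S \<mu>(1) pos_cont_inverse[OF f]] d1 by simp
    have 2: "emeasure \<nu>\<^sub>2 S = ennreal (\<integral>x. 1 / g x \<partial>\<mu>\<^sub>2)"
      using finite_density_pos_cont(1)[OF S \<mu>(2) pos_cont_inverse[OF g]] d2 by simp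
    show "(\<integral>x. 1 / f x \<partial>\<mu>\<^sub>1) = (\<integral>y. 1 / g y \<partial>\<mu>\<^sub>2)"
      using norm pos_integral_cont[OF S \<mu>(1) pos_cont_inverse[OF f]]
        pos_integral_cont[OF S \<mu>(2) pos_cont_inverse[OF g]]
      unfolding 1 2 by (simp add: ennreal_inj less_imp_le)
  qed
  then show ?thesis using that d1 d2 by blast
qed

text \<open>Discharges the definite description: any potentials whatever describe the normalized
  pair explicitly, and from here on the pair is handled only through them.\<close>

lemma schroedinger_pair_eq:
  assumes S: "compact S" and \<mu>: "\<mu>\<^sub>1 \<in> borel_probs S" "\<mu>\<^sub>2 \<in> borel_probs S" and q: "pos_cont (S \<times> S) q"
    and fg: "schroedinger_potentials S q \<mu>\<^sub>1 \<mu>\<^sub>2 f g"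
  shows "schroedinger_nu1 S q \<mu>\<^sub>1 \<mu>\<^sub>2 = density \<mu>\<^sub>1 (\<lambda>x. ennreal (1 / f x))"
    and "schroedinger_nu2 S q \<mu>\<^sub>1 \<mu>\<^sub>2 = density \<mu>\<^sub>2 (\<lambda>x. ennreal (1 / g x))"
proof -
  let ?p = "(density \<mu>\<^sub>1 (\<lambda>x. ennreal (1 / f x)), density \<mu>\<^sub>2 (\<lambda>x. ennreal (1 / g x)))"
  have "schroedinger_pair S q \<mu>\<^sub>1 \<mu>\<^sub>2 = ?p"
    unfolding schroedinger_pair_def
  proof (rule the_equality)
    show "schroedinger_solution S q \<mu>\<^sub>1 \<mu>\<^sub>2 (fst ?p) (snd ?p) \<and> emeasure (fst ?p) S = emeasure (snd ?p) S"
      using schroedinger_solution_of_potentials[OF assms] by simp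
  next
    fix p :: "'a measure \<times> 'a measure"
    assume "schroedinger_solution S q \<mu>\<^sub>1 \<mu>\<^sub>2 (fst p) (snd p) \<and> emeasure (fst p) S = emeasure (snd p) S"
    then obtain f' g' where fg': "schroedinger_potentials S q \<mu>\<^sub>1 \<mu>\<^sub>2 f' g'"
      and p: "fst p = density \<mu>\<^sub>1 (\<lambda>x. ennreal (1 / f' x))" "snd p = density \<mu>\<^sub>2 (\<lambda>x. ennreal (1 / g' x))"
      using potentials_of_schroedinger_solution[OF S \<mu> q] by metis
    \<comment> \<open>The potentials agree on \<open>S\<close>, which is the whole space of both
      marginals, so the densities define the same measures.\<close>
    have "fst p = fst ?p" "snd p = snd ?p"
      unfolding p fst_conv snd_conv
      using schroedinger_potentials_unique[OF S \<mu> q fg' fg] borel_probsD(3)[OF \<mu>(1)] borel_probsD(3)[OF \<mu>(2)]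
      by (auto intro!: density_cong_space)
    then show "p = ?p" by (rule prod_eqI)
  qed
  then show "schroedinger_nu1 S q \<mu>\<^sub>1 \<mu>\<^sub>2 = density \<mu>\<^sub>1 (\<lambda>x. ennreal (1 / f x))"
    and "schroedinger_nu2 S q \<mu>\<^sub>1 \<mu>\<^sub>2 = density \<mu>\<^sub>2 (\<lambda>x. ennreal (1 / g x))"
    by (simp_all add: schroedinger_nu1_def schroedinger_nu2_def)
qed

lemma schroedinger_u_eq:
  assumes S: "compact S" and \<mu>: "\<mu>\<^sub>1 \<in> borel_probs S" "\<mu>\<^sub>2 \<in> borel_probs S" and q: "pos_cont (S \<times> S) q"
    and fg: "schroedinger_potentials S q \<mu>\<^sub>1 \<mu>\<^sub>2 f g" and x: "x \<in> S"
  shows "schroedinger_u1 S q \<mu>\<^sub>1 \<mu>\<^sub>2 x = ln (f x)" and "schroedinger_u2 S q \<mu>\<^sub>1 \<mu>\<^sub>2 x = ln (g x)"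
proof -
  note q' = pos_cont_swap[OF q]
  have f: "pos_cont S f" and g: "pos_cont S g"
    and fe: "f x = schroedinger_op \<mu>\<^sub>2 q g x" and ge: "g x = schroedinger_op \<mu>\<^sub>1 (q \<circ> prod.swap) f x"
    using fg x by (auto simp: schroedinger_potentials_def)
  show "schroedinger_u1 S q \<mu>\<^sub>1 \<mu>\<^sub>2 x = ln (f x)"
    using integral_density_pos_cont[OF \<mu>(2) pos_cont_inverse[OF g], of "\<lambda>y. q (x, y)"] pos_cont_section[OF q x]
    unfolding schroedinger_u1_def schroedinger_pair_eq[OF S \<mu> q fg] fe
    by (simp add: schroedinger_op_def pos_cont_def)
  show "schroedinger_u2 S q \<mu>\<^sub>1 \<mu>\<^sub>2 x = ln (g x)"
    using integral_density_pos_cont[OF \<mu>(1) pos_cont_inverse[OF f], of "\<lambda>y. (q \<circ> prod.swap) (x, y)"]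
      pos_cont_section[OF q' x]
    unfolding schroedinger_u2_def schroedinger_pair_eq[OF S \<mu> q fg] ge
    by (simp add: schroedinger_op_def pos_cont_def)
qed

subsection \<open>Stability of the potentials\<close>

text \<open>The parametric version applied to integrands that ignore the parameter, evaluated at
  \<open>x0\<close>.\<close>

lemma tendsto_integral_norm_conv:
  fixes \<psi>n :: "nat \<Rightarrow> 'a::metric_space \<Rightarrow> real"
  assumes S: "compact S" and x0: "x0 \<in> S" and \<mu>n: "\<forall>\<^sub>F n in sequentially. \<mu>n n \<in> borel_probs S"
    and conv: "norm_conv S \<mu>n \<mu>"
    and \<psi>n: "\<forall>\<^sub>F n in sequentially. continuous_on S (\<psi>n n)" and \<psi>: "continuous_on S \<psi>"
    and lim: "uniform_limit S \<psi>n \<psi> sequentially"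
  shows "(\<lambda>n. \<integral>x. \<psi>n n x \<partial>\<mu>n n) \<longlonglongrightarrow> (\<integral>x. \<psi> x \<partial>\<mu>)"
proof -
  have cont: "continuous_on (S \<times> S) (\<lambda>z. f (snd z))" if "continuous_on S f" for f :: "'a \<Rightarrow> real"
    by (auto intro!: continuous_on_compose2[OF that] continuous_intros)
  have "uniform_limit S (\<lambda>n x. \<integral>y. \<psi>n n (snd (x, y)) \<partial>\<mu>n n) (\<lambda>x. \<integral>y. \<psi> (snd (x, y)) \<partial>\<mu>) sequentially"
  proof (rule uniform_limit_integral_param[OF S \<mu>n conv _ cont[OF \<psi>]])
    show "\<forall>\<^sub>F n in sequentially. continuous_on (S \<times> S) (\<lambda>z. \<psi>n n (snd z))"
      using \<psi>n by eventually_elim (rule cont)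
    show "uniform_limit (S \<times> S) (\<lambda>n z. \<psi>n n (snd z)) (\<lambda>z. \<psi> (snd z)) sequentially"
      by (rule uniform_limit_compose'[OF lim]) auto
  qed
  from tendsto_uniform_limitI[OF this x0] show ?thesis by simp
qed

lemma uniform_limit_scale_tendsto_1:
  fixes f :: "'a::topological_space \<Rightarrow> real"
  assumes "compact X" "continuous_on X f" "uniform_limit X fn f F" "(s \<longlongrightarrow> 1) F"
  shows "uniform_limit X (\<lambda>n x. s n * fn n x) f F"
proof -
  have "uniform_limit X (\<lambda>n x. s n) (\<lambda>x. 1) F"
    using assms(4) by (intro uniform_limitI) (auto dest!: tendstoD)
  moreover have "bounded (f ` X)"
    using assms compact_continuous_image compact_imp_bounded by blast
  moreover have "bounded ((\<lambda>x. 1::real) ` X)" by (auto simp: image_constant_conv)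
  ultimately have "uniform_limit X (\<lambda>n x. s n * fn n x) (\<lambda>x. 1 * f x) F"
    using assms(3) by (intro uniform_lim_mult)
  then show ?thesis by simp
qed

text \<open>A triangle inequality for the projective distance: from \<open>fn n\<close>, a fixed
  point of the perturbed cycle, to the perturbed image of \<open>f\<close> the cycle contracts; from
  there to \<open>f\<close> the distance is small because the perturbed cycles of \<open>f\<close>
  converge uniformly to \<open>f\<close>.\<close>

lemma schroedinger_potentials_ratio_tendsto:
  assumes S: "compact S" and \<mu>: "\<mu>\<^sub>1 \<in> borel_probs S" "\<mu>\<^sub>2 \<in> borel_probs S" and q: "pos_cont (S \<times> S) q"
    and \<mu>n: "\<forall>\<^sub>F n in sequentially. \<mu>\<^sub>1n n \<in> borel_probs S" "\<forall>\<^sub>F n in sequentially. \<mu>\<^sub>2n n \<in> borel_probs S"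
    and qn: "\<forall>\<^sub>F n in sequentially. pos_cont (S \<times> S) (qn n)"
    and qlim: "uniform_limit (S \<times> S) qn q sequentially"
    and conv: "norm_conv S \<mu>\<^sub>1n \<mu>\<^sub>1" "norm_conv S \<mu>\<^sub>2n \<mu>\<^sub>2"
    and fgn: "\<forall>\<^sub>F n in sequentially. schroedinger_potentials S (qn n) (\<mu>\<^sub>1n n) (\<mu>\<^sub>2n n) (fn n) (gn n)"
    and fg: "schroedinger_potentials S q \<mu>\<^sub>1 \<mu>\<^sub>2 f g"
    and r: "1 < r"
  shows "\<forall>\<^sub>F n in sequentially. ratio_le S r (fn n) f"
proof -
  have f: "pos_cont S f" using fg by (simp add: schroedinger_potentials_def)
  obtain m M where m: "0 < m" "0 < M"
    and mM: "\<forall>\<^sub>F n in sequentially. \<forall>z\<in>S \<times> S. m \<le> qn n z \<and> qn n z \<le> M"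
    by (rule uniform_limit_pos_bounds[OF compact_Times[OF S S] q qlim]) blast
  define c where "c = (m / M)\<^sup>2"
  have c: "0 < c" using m by (simp add: c_def)
  \<comment> \<open>The bound tends to 1 as \<open>E\<close> decreases to 1, so some
    \<open>E\<close> above 1 pushes it below the prescribed \<open>r\<close>; this \<open>E\<close>
    depends only on \<open>c\<close> and \<open>r\<close>.\<close>
  have lim1: "((\<lambda>E. c * E / (1 - (1 - c) * E)) \<longlongrightarrow> c * 1 / (1 - (1 - c) * 1)) (at_right 1)"
    using c by (intro tendsto_intros) auto
  have lim2: "((\<lambda>E. (1 - c) * E) \<longlongrightarrow> (1 - c) * 1) (at_right 1)"
    by (intro tendsto_intros)
  have "\<forall>\<^sub>F E in at_right 1. c * E / (1 - (1 - c) * E) < r"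
    by (rule order_tendstoD[OF lim1]) (use r c in simp)
  moreover have "\<forall>\<^sub>F E in at_right 1. (1 - c) * E < 1"
    by (rule order_tendstoD[OF lim2]) (use c in simp)
  moreover have "\<forall>\<^sub>F E in at_right 1. (1::real) < E" by (rule eventually_at_right_less)
  ultimately have "\<forall>\<^sub>F E in at_right 1. 1 < E \<and> (1 - c) * E < 1 \<and> c * E / (1 - (1 - c) * E) < r"
    by eventually_elim blast
  then obtain E where E: "1 < E" "(1 - c) * E < 1" "c * E / (1 - (1 - c) * E) < r"
    using eventually_happens trivial_limit_at_right_real by blast
  have qlim': "uniform_limit (S \<times> S) (\<lambda>n. qn n \<circ> prod.swap) (q \<circ> prod.swap) sequentially"
    unfolding comp_def by (rule uniform_limit_compose'[OF qlim]) auto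
  have qn': "\<forall>\<^sub>F n in sequentially. pos_cont (S \<times> S) (qn n \<circ> prod.swap)"
    using qn by eventually_elim (rule pos_cont_swap)
  have fn': "\<forall>\<^sub>F n in sequentially. pos_cont S (schroedinger_op (\<mu>\<^sub>1n n) (qn n \<circ> prod.swap) f)"
    using \<mu>n(1) qn' by eventually_elim (rule pos_cont_schroedinger_op[OF S _ _ f])
  have "uniform_limit S (\<lambda>n. schroedinger_op (\<mu>\<^sub>1n n) (qn n \<circ> prod.swap) f)
          (schroedinger_op \<mu>\<^sub>1 (q \<circ> prod.swap) f) sequentially"
    by (rule uniform_limit_schroedinger_op[OF S \<mu>n(1) conv(1) qn' pos_cont_swap[OF q] qlim' _ f uniform_limit_const])
      (simp add: f)
  then have "uniform_limit S (\<lambda>n. round_trip (qn n) (\<mu>\<^sub>1n n) (\<mu>\<^sub>2n n) f) (round_trip q \<mu>\<^sub>1 \<mu>\<^sub>2 f) sequentially"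
    unfolding round_trip_def
    by (rule uniform_limit_schroedinger_op[OF S \<mu>n(2) conv(2) qn q qlim fn'
          pos_cont_schroedinger_op[OF S \<mu>(1) pos_cont_swap[OF q] f]])
  from uniform_limit_imp_ratio_le[OF S pos_cont_round_trip[OF S \<mu> q f] this E(1)]
  have "\<forall>\<^sub>F n in sequentially. ratio_le S E (round_trip (qn n) (\<mu>\<^sub>1n n) (\<mu>\<^sub>2n n) f) f"
    using round_trip_potentials[OF \<mu>(2) fg] by (simp cong: ratio_le_cong)
  with mM \<mu>n qn fgn show ?thesis
  proof eventually_elim
    case (elim n)
    note \<mu>n = elim(2,3)
    have fn: "pos_cont S (fn n)" using elim(5) by (simp add: schroedinger_potentials_def)
    have pos: "\<And>x. x \<in> S \<Longrightarrow> 0 < fn n x" "\<And>x. x \<in> S \<Longrightarrow> 0 < f x"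
      using f fn by (auto simp: pos_cont_def)
    let ?T = "round_trip (qn n) (\<mu>\<^sub>1n n) (\<mu>\<^sub>2n n)"
    \<comment> \<open>This initial constant may vary with \<open>n\<close>; the bound extracted from
      it does not.\<close>
    obtain r0 where r0: "ratio_le S r0 (fn n) f" using ex_ratio_le[OF S fn f] by blast
    have "ratio_le S (c * E / (1 - (1 - c) * E)) (fn n) f"
    proof (rule ratio_le_of_contraction[OF borel_probsD(4)[OF \<mu>(1)] pos r0 _ E(2)])
      fix r assume "ratio_le S r (fn n) f"
      from ratio_le_round_trip[OF S \<mu>n elim(4) m(1) _ fn f this, of M]
      have "ratio_le S (r - c * (r - 1)) (?T (fn n)) (?T f)"
        using elim(1) by (simp add: c_def)
      then have "ratio_le S (r - c * (r - 1)) (fn n) (?T f)"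
        using round_trip_potentials[OF \<mu>n(2) elim(5)] by (simp cong: ratio_le_cong)
      then show "ratio_le S ((r - c * (r - 1)) * E) (fn n) f"
        using elim(6) pos pos_cont_round_trip[OF S \<mu>n elim(4) f]
        by (intro ratio_le_trans[of S _ "fn n" "?T f" E f]) (auto simp: pos_cont_def)
    qed
    then show ?case by (rule ratio_le_mono) (use E(3) pos in auto)
  qed
qed

text \<open>After scaling by \<open>s n\<close> the first potentials converge uniformly; one
  application of the operator shows that the second ones converge after scaling by the inverse. The
  normalization at each \<open>n\<close> and in the limit then forces \<open>s n\<close> to tend to
  1, and the scaling can be undone.\<close>

lemma schroedinger_potentials_uniform_limit:
  assumes S: "compact S" and \<mu>: "\<mu>\<^sub>1 \<in> borel_probs S" "\<mu>\<^sub>2 \<in> borel_probs S" and q: "pos_cont (S \<times> S) q"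
    and \<mu>n: "\<forall>\<^sub>F n in sequentially. \<mu>\<^sub>1n n \<in> borel_probs S" "\<forall>\<^sub>F n in sequentially. \<mu>\<^sub>2n n \<in> borel_probs S"
    and qn: "\<forall>\<^sub>F n in sequentially. pos_cont (S \<times> S) (qn n)"
    and qlim: "uniform_limit (S \<times> S) qn q sequentially"
    and conv: "norm_conv S \<mu>\<^sub>1n \<mu>\<^sub>1" "norm_conv S \<mu>\<^sub>2n \<mu>\<^sub>2"
    and fgn: "\<forall>\<^sub>F n in sequentially. schroedinger_potentials S (qn n) (\<mu>\<^sub>1n n) (\<mu>\<^sub>2n n) (fn n) (gn n)"
    and fg: "schroedinger_potentials S q \<mu>\<^sub>1 \<mu>\<^sub>2 f g"
  shows "uniform_limit S fn f sequentially" "uniform_limit S gn g sequentially"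
proof -
  have f: "pos_cont S f" and g: "pos_cont S g"
    using fg by (simp_all add: schroedinger_potentials_def)
  have fgc: "continuous_on S f" "continuous_on S g" using f g by (simp_all add: pos_cont_def)
  have fn: "\<forall>\<^sub>F n in sequentially. pos_cont S (fn n)" and gn: "\<forall>\<^sub>F n in sequentially. pos_cont S (gn n)"
    using fgn by (eventually_elim, simp add: schroedinger_potentials_def)+
  obtain x0 where x0: "x0 \<in> S" using borel_probsD(4)[OF \<mu>(1)] by blast
  define s where "s n = f x0 / fn n x0" for n
  have s: "\<forall>\<^sub>F n in sequentially. 0 < s n"
    using fn by eventually_elim (use f x0 in \<open>auto simp: pos_cont_def s_def\<close>)
  have hlim: "uniform_limit S (\<lambda>n x. s n * fn n x) f sequentially"
    unfolding s_def
    by (rule ratio_le_imp_uniform_limit[OF S f x0 fn schroedinger_potentials_ratio_tendsto[OF assms]])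
  have hn: "\<forall>\<^sub>F n in sequentially. pos_cont S (\<lambda>x. s n * fn n x)"
    using fn s by eventually_elim (auto simp: pos_cont_def intro!: continuous_intros)
  have qlim': "uniform_limit (S \<times> S) (\<lambda>n. qn n \<circ> prod.swap) (q \<circ> prod.swap) sequentially"
    unfolding comp_def by (rule uniform_limit_compose'[OF qlim]) auto
  have qn': "\<forall>\<^sub>F n in sequentially. pos_cont (S \<times> S) (qn n \<circ> prod.swap)"
    using qn by eventually_elim (rule pos_cont_swap)
  have lim: "uniform_limit S (\<lambda>n. schroedinger_op (\<mu>\<^sub>1n n) (qn n \<circ> prod.swap) (\<lambda>x. s n * fn n x))
          (schroedinger_op \<mu>\<^sub>1 (q \<circ> prod.swap) f) sequentially"
    by (rule uniform_limit_schroedinger_op[OF S \<mu>n(1) conv(1) qn' pos_cont_swap[OF q] qlim' hn f hlim])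
  have ev: "\<forall>\<^sub>F n in sequentially. \<forall>x\<in>S.
      schroedinger_op (\<mu>\<^sub>1n n) (qn n \<circ> prod.swap) (\<lambda>x. s n * fn n x) x = inverse (s n) * gn n x"
    using fgn by eventually_elim (auto simp: schroedinger_op_scale schroedinger_potentials_def divide_inverse)
  have eq: "schroedinger_op \<mu>\<^sub>1 (q \<circ> prod.swap) f x = g x" if "x \<in> S" for x
    using fg that by (simp add: schroedinger_potentials_def)
  have klim: "uniform_limit S (\<lambda>n x. inverse (s n) * gn n x) g sequentially"
    by (rule iffD1[OF uniform_limit_cong[OF ev eq] lim])
  have kn: "\<forall>\<^sub>F n in sequentially. pos_cont S (\<lambda>x. inverse (s n) * gn n x)"
    using gn s by eventually_elim (auto simp: pos_cont_def intro!: continuous_intros)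
  have inv_lim: "(\<lambda>n. \<integral>x. 1 / h n x \<partial>\<mu>n n) \<longlonglongrightarrow> (\<integral>x. 1 / l x \<partial>\<mu>)"
    if "\<forall>\<^sub>F n in sequentially. \<mu>n n \<in> borel_probs S" "norm_conv S \<mu>n \<mu>"
      "\<forall>\<^sub>F n in sequentially. pos_cont S (h n)" "pos_cont S l" "uniform_limit S h l sequentially"
    for h :: "nat \<Rightarrow> 'a \<Rightarrow> real" and l \<mu>n \<mu>
  proof (rule tendsto_integral_norm_conv[OF S x0 that(1,2)])
    show "\<forall>\<^sub>F n in sequentially. continuous_on S (\<lambda>x. 1 / h n x)"
      using that(3) by eventually_elim (use pos_cont_inverse in \<open>auto simp: pos_cont_def\<close>)
    show "continuous_on S (\<lambda>x. 1 / l x)" using pos_cont_inverse[OF that(4)] by (simp add: pos_cont_def)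
    show "uniform_limit S (\<lambda>n x. 1 / h n x) (\<lambda>x. 1 / l x) sequentially"
      using that by (intro uniform_limit_divide_pos_cont[OF S] uniform_limit_const) auto
  qed
  define A where "A = (\<integral>x. 1 / f x \<partial>\<mu>\<^sub>1)"
  have A: "0 < A" unfolding A_def by (rule pos_integral_cont[OF S \<mu>(1) pos_cont_inverse[OF f]])
  have lima: "(\<lambda>n. \<integral>x. 1 / (s n * fn n x) \<partial>\<mu>\<^sub>1n n) \<longlonglongrightarrow> A"
    unfolding A_def by (rule inv_lim[OF \<mu>n(1) conv(1) hn f hlim])
  have "(\<lambda>n. \<integral>x. 1 / (inverse (s n) * gn n x) \<partial>\<mu>\<^sub>2n n) \<longlonglongrightarrow> (\<integral>x. 1 / g x \<partial>\<mu>\<^sub>2)"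
    by (rule inv_lim[OF \<mu>n(2) conv(2) kn g klim])
  then have limb: "(\<lambda>n. \<integral>x. 1 / (inverse (s n) * gn n x) \<partial>\<mu>\<^sub>2n n) \<longlonglongrightarrow> A"
    using fg by (simp add: schroedinger_potentials_def A_def)
  have "(\<lambda>n. sqrt ((\<integral>x. 1 / (inverse (s n) * gn n x) \<partial>\<mu>\<^sub>2n n) / (\<integral>x. 1 / (s n * fn n x) \<partial>\<mu>\<^sub>1n n)))
      \<longlonglongrightarrow> sqrt (A / A)"
    using A by (intro tendsto_intros lima limb) simp
  \<comment> \<open>By the normalization at \<open>n\<close>, the two masses are
    \<open>s n * I\<close> and \<open>I / s n\<close> with the same \<open>I\<close>, so their
    quotient is the square of \<open>s n\<close>. Both masses converge to \<open>A\<close>.\<close>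
  moreover have "\<forall>\<^sub>F n in sequentially.
      sqrt ((\<integral>x. 1 / (inverse (s n) * gn n x) \<partial>\<mu>\<^sub>2n n) / (\<integral>x. 1 / (s n * fn n x) \<partial>\<mu>\<^sub>1n n)) = s n"
    using s fgn \<mu>n(1) fn
  proof eventually_elim
    case (elim n)
    define I where "I = (\<integral>x. 1 / fn n x \<partial>\<mu>\<^sub>1n n)"
    have I: "0 < I" unfolding I_def by (rule pos_integral_cont[OF S elim(3) pos_cont_inverse[OF elim(4)]])
    have "(\<integral>x. 1 / (s n * fn n x) \<partial>\<mu>\<^sub>1n n) = (\<integral>x. inverse (s n) * (1 / fn n x) \<partial>\<mu>\<^sub>1n n)"
      by (simp add: field_simps)
    also have "\<dots> = inverse (s n) * I" by (simp only: integral_mult_right_zero I_def)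
    finally have 1: "(\<integral>x. 1 / (s n * fn n x) \<partial>\<mu>\<^sub>1n n) = inverse (s n) * I" .
    have "(\<integral>x. 1 / (inverse (s n) * gn n x) \<partial>\<mu>\<^sub>2n n) = (\<integral>x. s n * (1 / gn n x) \<partial>\<mu>\<^sub>2n n)"
      by (simp add: field_simps)
    also have "\<dots> = s n * (\<integral>x. 1 / gn n x \<partial>\<mu>\<^sub>2n n)" by (simp only: integral_mult_right_zero)
    also have "(\<integral>x. 1 / gn n x \<partial>\<mu>\<^sub>2n n) = I"
      using elim(2) by (simp add: schroedinger_potentials_def I_def)
    finally have 2: "(\<integral>x. 1 / (inverse (s n) * gn n x) \<partial>\<mu>\<^sub>2n n) = s n * I" .
    have "s n * I / (inverse (s n) * I) = s n * s n" using I elim(1) by (simp add: field_simps)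
    then show ?case unfolding 1 2 using elim(1) by simp
  qed
  ultimately have "s \<longlonglongrightarrow> sqrt (A / A)" by (rule Lim_transform_eventually)
  then have slim: "s \<longlonglongrightarrow> 1" using A by simp
  then have "(\<lambda>n. inverse (s n)) \<longlonglongrightarrow> inverse 1" by (intro tendsto_inverse) auto
  then have slim': "(\<lambda>n. inverse (s n)) \<longlonglongrightarrow> 1" by simp
  have lim: "uniform_limit S (\<lambda>n x. inverse (s n) * (s n * fn n x)) f sequentially"
    by (rule uniform_limit_scale_tendsto_1[OF S fgc(1) hlim slim'])
  have ev: "\<forall>\<^sub>F n in sequentially. \<forall>x\<in>S. inverse (s n) * (s n * fn n x) = fn n x"
    using s by eventually_elim simp
  show "uniform_limit S fn f sequentially"
    by (rule iffD1[OF uniform_limit_cong[OF ev refl] lim])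
  have lim: "uniform_limit S (\<lambda>n x. s n * (inverse (s n) * gn n x)) g sequentially"
    by (rule uniform_limit_scale_tendsto_1[OF S fgc(2) klim slim])
  have ev: "\<forall>\<^sub>F n in sequentially. \<forall>x\<in>S. s n * (inverse (s n) * gn n x) = gn n x"
    using s by eventually_elim simp
  show "uniform_limit S gn g sequentially"
    by (rule iffD1[OF uniform_limit_cong[OF ev refl] lim])
qed

section \<open>Supremum norms versus uniform convergence and convergence on test functions\<close>

lemma sup_norm_on_le_iff:
  assumes "compact X" "X \<noteq> {}" "continuous_on X \<phi>"
  shows "sup_norm_on X \<phi> \<le> c \<longleftrightarrow> (\<forall>x\<in>X. \<bar>\<phi> x\<bar> \<le> c)"
proof -
  have "compact ((\<lambda>x. \<bar>\<phi> x\<bar>) ` X)"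
    using assms by (intro compact_continuous_image continuous_intros)
  then have "bdd_above ((\<lambda>x. \<bar>\<phi> x\<bar>) ` X)"
    by (intro bounded_imp_bdd_above compact_imp_bounded)
  then show ?thesis unfolding sup_norm_on_def by (rule cSUP_le_iff[OF assms(2)])
qed

lemma sup_norm_on_nonneg:
  assumes "compact X" "X \<noteq> {}" "continuous_on X \<phi>"
  shows "0 \<le> sup_norm_on X \<phi>"
  using sup_norm_on_le_iff[OF assms, of "sup_norm_on X \<phi>"] assms(2) by (auto intro: order_trans[OF abs_ge_zero])

lemma uniform_limit_imp_sup_norm_on:
  assumes "X \<noteq> {}" "uniform_limit X fn f F"
  shows "((\<lambda>n. sup_norm_on X (\<lambda>x. fn n x - f x)) \<longlongrightarrow> 0) F"
proof (rule tendstoI)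
  fix e :: real assume e: "0 < e"
  then have "0 < e / 2" by simp
  from uniform_limitD[OF assms(2) this]
  show "\<forall>\<^sub>F n in F. dist (sup_norm_on X (\<lambda>x. fn n x - f x)) 0 < e"
  proof eventually_elim
    case (elim n)
    have "\<bar>sup_norm_on X (\<lambda>x. fn n x - f x)\<bar> \<le> e / 2"
      unfolding sup_norm_on_def
      by (rule cSup_abs_le) (use assms(1) elim in \<open>auto simp: dist_real_def intro: less_imp_le\<close>)
    then show ?case using e by simp
  qed
qed

lemma sup_norm_on_imp_uniform_limit:
  assumes "compact X" "X \<noteq> {}" "\<forall>\<^sub>F n in F. continuous_on X (fn n)" "continuous_on X f"
    and "((\<lambda>n. sup_norm_on X (\<lambda>x. fn n x - f x)) \<longlongrightarrow> 0) F"
  shows "uniform_limit X fn f F"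
proof (rule uniform_limitI)
  fix e :: real assume e: "0 < e"
  show "\<forall>\<^sub>F n in F. \<forall>x\<in>X. dist (fn n x) (f x) < e"
    using assms(3) order_tendstoD(2)[OF assms(5) e]
  proof eventually_elim
    case (elim n)
    have "continuous_on X (\<lambda>x. fn n x - f x)" using elim(1) assms(4) by (intro continuous_intros)
    from sup_norm_on_le_iff[OF assms(1,2) this, of "sup_norm_on X (\<lambda>x. fn n x - f x)"]
    show ?case using elim(2) unfolding dist_real_def by fastforce
  qed
qed

lemma norm_conv_imp_measure_diff_norm:
  assumes X: "compact X" "X \<noteq> {}" and conv: "norm_conv X \<mu>n \<mu>"
  shows "(\<lambda>n. measure_diff_norm X (\<mu>n n) \<mu>) \<longlonglongrightarrow> 0"
proof (rule tendstoI)
  fix e :: real assume e: "0 < e"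
  then have "0 < e / 2" by simp
  from conv[unfolded norm_conv_def, rule_format, OF this]
  show "\<forall>\<^sub>F n in sequentially. dist (measure_diff_norm X (\<mu>n n) \<mu>) 0 < e"
  proof eventually_elim
    case (elim n)
    \<comment> \<open>The zero test function keeps the family nonempty, so a bound on all its values
      passes to the supremum.\<close>
    have "continuous_on X (\<lambda>_. 0::real)" "sup_norm_on X (\<lambda>_. 0) \<le> 1"
      using X by (auto simp: sup_norm_on_def)
    then have "{\<phi>. continuous_on X \<phi> \<and> sup_norm_on X \<phi> \<le> 1} \<noteq> {}" by blast
    then have "\<bar>measure_diff_norm X (\<mu>n n) \<mu>\<bar> \<le> e / 2"
      unfolding measure_diff_norm_def
      by (intro cSup_abs_le) (use elim sup_norm_on_le_iff[OF X] in auto)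
    then show ?case using e by simp
  qed
qed

lemma integral_abs_le_1:
  fixes \<phi> :: "'a \<Rightarrow> real"
  assumes "prob_space M" "\<And>x. x \<in> space M \<Longrightarrow> \<bar>\<phi> x\<bar> \<le> 1"
  shows "\<bar>\<integral>x. \<phi> x \<partial>M\<bar> \<le> 1"
proof (cases "integrable M \<phi>")
  case True
  interpret prob_space M by fact
  have "\<bar>\<integral>x. \<phi> x \<partial>M\<bar> \<le> (\<integral>x. 1 \<partial>M)"
    using True assms(2) by (intro order_trans[OF integral_abs_bound] integral_mono) auto
  then show ?thesis by (simp add: prob_space)
qed (simp add: not_integrable_integral_eq)

text \<open>The values are bounded by 2 for probability measures, which makes the real supremum a
  genuine upper bound.\<close>

lemma measure_diff_norm_upper:
  assumes X: "compact X" "X \<noteq> {}" and M: "prob_space M" "space M = X" and N: "prob_space N" "space N = X"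
    and \<phi>: "continuous_on X \<phi>" "\<And>x. x \<in> X \<Longrightarrow> \<bar>\<phi> x\<bar> \<le> 1"
  shows "(\<integral>x. \<phi> x \<partial>M) - (\<integral>x. \<phi> x \<partial>N) \<le> measure_diff_norm X M N"
  unfolding measure_diff_norm_def
proof (rule cSUP_upper)
  show "\<phi> \<in> {\<phi>. continuous_on X \<phi> \<and> sup_norm_on X \<phi> \<le> 1}"
    using \<phi> sup_norm_on_le_iff[OF X \<phi>(1)] by auto
  have "(\<integral>x. \<psi> x \<partial>M) - (\<integral>x. \<psi> x \<partial>N) \<le> 2" if "continuous_on X \<psi>" "sup_norm_on X \<psi> \<le> 1" for \<psi>
  proof -
    have "\<And>x. x \<in> X \<Longrightarrow> \<bar>\<psi> x\<bar> \<le> 1" using that sup_norm_on_le_iff[OF X that(1)] by auto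
    then have "\<bar>\<integral>x. \<psi> x \<partial>M\<bar> \<le> 1" "\<bar>\<integral>x. \<psi> x \<partial>N\<bar> \<le> 1"
      using integral_abs_le_1[OF M(1)] integral_abs_le_1[OF N(1)] M(2) N(2) by auto
    then show ?thesis by linarith
  qed
  then show "bdd_above ((\<lambda>\<phi>. (\<integral>x. \<phi> x \<partial>M) - (\<integral>x. \<phi> x \<partial>N)) ` {\<phi>. continuous_on X \<phi> \<and> sup_norm_on X \<phi> \<le> 1})"
    by (intro bdd_aboveI[of _ 2]) auto
qed

lemma measure_diff_norm_nonneg:
  assumes "compact X" "X \<noteq> {}" "prob_space M" "space M = X" "prob_space N" "space N = X"
  shows "0 \<le> measure_diff_norm X M N"
  using measure_diff_norm_upper[OF assms, of "\<lambda>_. 0"] by simp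

lemma measure_diff_norm_imp_norm_conv:
  assumes X: "compact X" "X \<noteq> {}"
    and \<mu>n: "\<forall>\<^sub>F n in sequentially. prob_space (\<mu>n n) \<and> space (\<mu>n n) = X" and \<mu>: "prob_space \<mu>" "space \<mu> = X"
    and lim: "(\<lambda>n. measure_diff_norm X (\<mu>n n) \<mu>) \<longlonglongrightarrow> 0"
  shows "norm_conv X \<mu>n \<mu>"
  unfolding norm_conv_def
proof (intro allI impI)
  fix e :: real assume e: "0 < e"
  show "\<forall>\<^sub>F n in sequentially. \<forall>\<phi> :: 'a \<Rightarrow> real.
     continuous_on X \<phi> \<and> (\<forall>x\<in>X. \<bar>\<phi> x\<bar> \<le> 1) \<longrightarrow> \<bar>(\<integral>x. \<phi> x \<partial>\<mu>n n) - (\<integral>x. \<phi> x \<partial>\<mu>)\<bar> \<le> e"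
    using \<mu>n order_tendstoD(2)[OF lim e]
  proof eventually_elim
    case (elim n)
    show ?case
    proof (intro allI impI)
      fix \<phi> :: "'a \<Rightarrow> real" assume \<phi>: "continuous_on X \<phi> \<and> (\<forall>x\<in>X. \<bar>\<phi> x\<bar> \<le> 1)"
      note up = measure_diff_norm_upper[OF X conjunct1[OF elim(1)] conjunct2[OF elim(1)] \<mu>]
      \<comment> \<open>The norm has no absolute value inside; testing with the negative of
        \<open>\<phi>\<close> supplies the other sign.\<close>
      have "continuous_on X (\<lambda>x. - \<phi> x)" using \<phi> by (intro continuous_intros) auto
      from up[OF this] up[of \<phi>] show "\<bar>(\<integral>x. \<phi> x \<partial>\<mu>n n) - (\<integral>x. \<phi> x \<partial>\<mu>)\<bar> \<le> e"
        using \<phi> elim(2) by auto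
    qed
  qed
qed

section \<open>Product measures: marginals and densities\<close>

lemma integral_pair_marginals:
  fixes \<phi> :: "'a::metric_space \<Rightarrow> real"
  assumes S: "compact S" and M: "M \<in> borel_probs S" and N: "N \<in> borel_probs S" and \<phi>: "continuous_on S \<phi>"
  shows "(\<integral>z. \<phi> (fst z) \<partial>(M \<Otimes>\<^sub>M N)) = (\<integral>x. \<phi> x \<partial>M)"
    and "(\<integral>z. \<phi> (snd z) \<partial>(M \<Otimes>\<^sub>M N)) = (\<integral>x. \<phi> x \<partial>N)"
proof -
  note p1 = borel_probsD[OF M] and p2 = borel_probsD[OF N]
  interpret P1: prob_space M by (rule p1)
  interpret P2: prob_space N by (rule p2)
  interpret P: pair_prob_space M N ..
  note int = integrable_cont_pair[OF S P1.finite_measure_axioms p1(2) P2.finite_measure_axioms p2(2)]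
  have c: "continuous_on (S \<times> S) (\<lambda>z. \<phi> (fst z))" "continuous_on (S \<times> S) (\<lambda>z. \<phi> (snd z))"
    by (auto intro!: continuous_on_compose2[OF \<phi>] continuous_intros)
  show "(\<integral>z. \<phi> (fst z) \<partial>(M \<Otimes>\<^sub>M N)) = (\<integral>x. \<phi> x \<partial>M)"
    using P.integral_fst'[OF int[OF c(1)]] by (simp add: P2.prob_space)
  show "(\<integral>z. \<phi> (snd z) \<partial>(M \<Otimes>\<^sub>M N)) = (\<integral>x. \<phi> x \<partial>N)"
    using P.integral_fst'[OF int[OF c(2)]] by (simp add: P1.prob_space)
qed

text \<open>A function of one coordinate is an admissible test function on the product, and its
  integral there is the integral against that marginal because the other factor has mass
  one.\<close>

lemma norm_conv_marginals:
  fixes \<mu>\<^sub>1 \<mu>\<^sub>2 :: "'a::metric_space measure"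
  assumes S: "compact S" and \<mu>: "\<mu>\<^sub>1 \<in> borel_probs S" "\<mu>\<^sub>2 \<in> borel_probs S"
    and \<mu>n: "\<forall>\<^sub>F n in sequentially. \<mu>\<^sub>1n n \<in> borel_probs S" "\<forall>\<^sub>F n in sequentially. \<mu>\<^sub>2n n \<in> borel_probs S"
    and conv: "norm_conv (S \<times> S) (\<lambda>n. \<mu>\<^sub>1n n \<Otimes>\<^sub>M \<mu>\<^sub>2n n) (\<mu>\<^sub>1 \<Otimes>\<^sub>M \<mu>\<^sub>2)"
  shows "norm_conv S \<mu>\<^sub>1n \<mu>\<^sub>1" "norm_conv S \<mu>\<^sub>2n \<mu>\<^sub>2"
proof -
  have c: "continuous_on (S \<times> S) (\<lambda>z. \<phi> (fst z))" "continuous_on (S \<times> S) (\<lambda>z. \<phi> (snd z))"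
    if "continuous_on S \<phi>" for \<phi> :: "'a \<Rightarrow> real"
    by (auto intro!: continuous_on_compose2[OF that] continuous_intros)
  show "norm_conv S \<mu>\<^sub>1n \<mu>\<^sub>1"
    unfolding norm_conv_def
  proof (intro allI impI)
    fix e :: real assume e: "0 < e"
    show "\<forall>\<^sub>F n in sequentially. \<forall>\<phi>. continuous_on S \<phi> \<and> (\<forall>x\<in>S. \<bar>\<phi> x\<bar> \<le> 1) \<longrightarrow>
        \<bar>(\<integral>x. \<phi> x \<partial>\<mu>\<^sub>1n n) - (\<integral>x. \<phi> x \<partial>\<mu>\<^sub>1)\<bar> \<le> e"
      using \<mu>n conv[unfolded norm_conv_def, rule_format, OF e]
    proof eventually_elim
      case (elim n)
      show ?case
      proof (intro allI impI)
        fix \<phi> :: "'a \<Rightarrow> real" assume \<phi>: "continuous_on S \<phi> \<and> (\<forall>x\<in>S. \<bar>\<phi> x\<bar> \<le> 1)"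
        then show "\<bar>(\<integral>x. \<phi> x \<partial>\<mu>\<^sub>1n n) - (\<integral>x. \<phi> x \<partial>\<mu>\<^sub>1)\<bar> \<le> e"
          using elim(3)[rule_format, of "\<lambda>z. \<phi> (fst z)"] c(1)[of \<phi>]
            integral_pair_marginals(1)[OF S elim(1,2), of \<phi>] integral_pair_marginals(1)[OF S \<mu>, of \<phi>]
          by auto
      qed
    qed
  qed
  show "norm_conv S \<mu>\<^sub>2n \<mu>\<^sub>2"
    unfolding norm_conv_def
  proof (intro allI impI)
    fix e :: real assume e: "0 < e"
    show "\<forall>\<^sub>F n in sequentially. \<forall>\<phi>. continuous_on S \<phi> \<and> (\<forall>x\<in>S. \<bar>\<phi> x\<bar> \<le> 1) \<longrightarrow>
        \<bar>(\<integral>x. \<phi> x \<partial>\<mu>\<^sub>2n n) - (\<integral>x. \<phi> x \<partial>\<mu>\<^sub>2)\<bar> \<le> e"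
      using \<mu>n conv[unfolded norm_conv_def, rule_format, OF e]
    proof eventually_elim
      case (elim n)
      show ?case
      proof (intro allI impI)
        fix \<phi> :: "'a \<Rightarrow> real" assume \<phi>: "continuous_on S \<phi> \<and> (\<forall>x\<in>S. \<bar>\<phi> x\<bar> \<le> 1)"
        then show "\<bar>(\<integral>x. \<phi> x \<partial>\<mu>\<^sub>2n n) - (\<integral>x. \<phi> x \<partial>\<mu>\<^sub>2)\<bar> \<le> e"
          using elim(3)[rule_format, of "\<lambda>z. \<phi> (snd z)"] c(2)[of \<phi>]
            integral_pair_marginals(2)[OF S elim(1,2), of \<phi>] integral_pair_marginals(2)[OF S \<mu>, of \<phi>]
          by auto
      qed
    qed
  qed
qed

lemma space_pair_borel_probs:
  assumes "\<mu>\<^sub>1 \<in> borel_probs S" "\<mu>\<^sub>2 \<in> borel_probs S"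
  shows "prob_space (\<mu>\<^sub>1 \<Otimes>\<^sub>M \<mu>\<^sub>2)" "space (\<mu>\<^sub>1 \<Otimes>\<^sub>M \<mu>\<^sub>2) = S \<times> S"
proof -
  note p1 = borel_probsD[OF assms(1)] and p2 = borel_probsD[OF assms(2)]
  show "prob_space (\<mu>\<^sub>1 \<Otimes>\<^sub>M \<mu>\<^sub>2)" using prob_space_pair[OF p1(1) p2(1)] .
  show "space (\<mu>\<^sub>1 \<Otimes>\<^sub>M \<mu>\<^sub>2) = S \<times> S" using p1(3) p2(3) by (simp add: space_pair_measure)
qed

lemma pos_cont_tensor:
  assumes "pos_cont S f" "pos_cont S g"
  shows "pos_cont (S \<times> S) (\<lambda>z. f (fst z) * g (snd z))"
  using assms unfolding pos_cont_def
  by (auto intro!: continuous_on_mult continuous_on_compose2[of S f] continuous_on_compose2[of S g] continuous_intros)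

lemma integral_pair_density:
  fixes \<phi> :: "'a::metric_space \<times> 'a \<Rightarrow> real"
  assumes S: "compact S" and \<mu>: "\<mu>\<^sub>1 \<in> borel_probs S" "\<mu>\<^sub>2 \<in> borel_probs S"
    and a: "pos_cont S a" and b: "pos_cont S b" and \<phi>: "continuous_on (S \<times> S) \<phi>"
  shows "(\<integral>z. \<phi> z \<partial>(density \<mu>\<^sub>1 (\<lambda>x. ennreal (a x)) \<Otimes>\<^sub>M density \<mu>\<^sub>2 (\<lambda>x. ennreal (b x))))
       = (\<integral>z. a (fst z) * b (snd z) * \<phi> z \<partial>(\<mu>\<^sub>1 \<Otimes>\<^sub>M \<mu>\<^sub>2))"
proof -
  note p1 = borel_probsD[OF \<mu>(1)] and p2 = borel_probsD[OF \<mu>(2)] and p = space_pair_borel_probs[OF \<mu>]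
  have "density \<mu>\<^sub>1 (\<lambda>x. ennreal (a x)) \<Otimes>\<^sub>M density \<mu>\<^sub>2 (\<lambda>x. ennreal (b x))
      = density (\<mu>\<^sub>1 \<Otimes>\<^sub>M \<mu>\<^sub>2) (\<lambda>(x, y). ennreal (a x) * ennreal (b y))"
  proof (rule pair_measure_density)
    show "(\<lambda>x. ennreal (a x)) \<in> borel_measurable \<mu>\<^sub>1" "(\<lambda>x. ennreal (b x)) \<in> borel_measurable \<mu>\<^sub>2"
      using borel_measurable_cont_restrict[OF p1(2)] borel_measurable_cont_restrict[OF p2(2)] a b
      by (auto simp: pos_cont_def)
    show "sigma_finite_measure \<mu>\<^sub>2" "sigma_finite_measure (density \<mu>\<^sub>2 (\<lambda>x. ennreal (b x)))"
      using prob_space.finite_measure[OF p2(1)] finite_density_pos_cont(2)[OF S \<mu>(2) b]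
      by (auto intro: finite_measure.axioms(1))
  qed
  also have "\<dots> = density (\<mu>\<^sub>1 \<Otimes>\<^sub>M \<mu>\<^sub>2) (\<lambda>z. ennreal (a (fst z) * b (snd z)))"
    using a b p(2) by (intro density_cong_space) (auto simp: pos_cont_def ennreal_mult' less_imp_le)
  also have "(\<integral>z. \<phi> z \<partial>\<dots>) = (\<integral>z. a (fst z) * b (snd z) * \<phi> z \<partial>(\<mu>\<^sub>1 \<Otimes>\<^sub>M \<mu>\<^sub>2))"
  proof (subst integral_density)
    show "\<phi> \<in> borel_measurable (\<mu>\<^sub>1 \<Otimes>\<^sub>M \<mu>\<^sub>2)"
      by (rule borel_measurable_cont_pair[OF S p1(2) p2(2) \<phi>])
    note ab = pos_cont_tensor[OF a b]
    show "(\<lambda>z. a (fst z) * b (snd z)) \<in> borel_measurable (\<mu>\<^sub>1 \<Otimes>\<^sub>M \<mu>\<^sub>2)"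
      using ab by (intro borel_measurable_cont_pair[OF S p1(2) p2(2)]) (simp add: pos_cont_def)
    show "AE z in \<mu>\<^sub>1 \<Otimes>\<^sub>M \<mu>\<^sub>2. 0 \<le> a (fst z) * b (snd z)"
      using ab p(2) by (intro AE_I2) (auto simp: pos_cont_def intro: less_imp_le)
  qed simp
  finally show ?thesis .
qed

text \<open>The weight is moved into the integrand. Replacing the weight at \<open>n\<close> by the
  limiting one costs its uniform error, since the test function is at most 1 and the product has
  mass one; replacing the measure is a test with \<open>?w z * \<phi> z\<close>, which is bounded by
  \<open>B\<close> for every \<open>\<phi>\<close>.\<close>

lemma norm_conv_pair_density:
  fixes \<mu>\<^sub>1 \<mu>\<^sub>2 :: "'a::metric_space measure"
  assumes S: "compact S" and \<mu>: "\<mu>\<^sub>1 \<in> borel_probs S" "\<mu>\<^sub>2 \<in> borel_probs S"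
    and \<mu>n: "\<forall>\<^sub>F n in sequentially. \<mu>\<^sub>1n n \<in> borel_probs S" "\<forall>\<^sub>F n in sequentially. \<mu>\<^sub>2n n \<in> borel_probs S"
    and conv: "norm_conv (S \<times> S) (\<lambda>n. \<mu>\<^sub>1n n \<Otimes>\<^sub>M \<mu>\<^sub>2n n) (\<mu>\<^sub>1 \<Otimes>\<^sub>M \<mu>\<^sub>2)"
    and an: "\<forall>\<^sub>F n in sequentially. pos_cont S (an n)" and a: "pos_cont S a" "uniform_limit S an a sequentially"
    and bn: "\<forall>\<^sub>F n in sequentially. pos_cont S (bn n)" and b: "pos_cont S b" "uniform_limit S bn b sequentially"
  shows "norm_conv (S \<times> S)
      (\<lambda>n. density (\<mu>\<^sub>1n n) (\<lambda>x. ennreal (an n x)) \<Otimes>\<^sub>M density (\<mu>\<^sub>2n n) (\<lambda>x. ennreal (bn n x)))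
      (density \<mu>\<^sub>1 (\<lambda>x. ennreal (a x)) \<Otimes>\<^sub>M density \<mu>\<^sub>2 (\<lambda>x. ennreal (b x)))"
  unfolding norm_conv_def
proof (intro allI impI)
  fix e :: real assume e: "0 < e"
  let ?wn = "\<lambda>n z. an n (fst z) * bn n (snd z)" and ?w = "\<lambda>z. a (fst z) * b (snd z)"
  note w = pos_cont_tensor[OF a(1) b(1)]
  obtain m B where B: "0 < B" "\<And>z. z \<in> S \<times> S \<Longrightarrow> m \<le> ?w z \<and> ?w z \<le> B"
    by (rule pos_cont_bounds[OF compact_Times[OF S S] w]) blast
  have "pos_cont (S \<times> S) (\<lambda>z. a (fst z))" "pos_cont (S \<times> S) (\<lambda>z. b (snd z))"
    using pos_cont_tensor[OF a(1), of "\<lambda>_. 1"] pos_cont_tensor[OF _ b(1), of "\<lambda>_. 1"]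
    by (simp_all add: pos_cont_def)
  then have bdd: "bounded ((\<lambda>z. a (fst z)) ` (S \<times> S))" "bounded ((\<lambda>z. b (snd z)) ` (S \<times> S))"
    using S compact_Times compact_continuous_image compact_imp_bounded unfolding pos_cont_def by blast+
  have "uniform_limit (S \<times> S) (\<lambda>n z. an n (fst z)) (\<lambda>z. a (fst z)) sequentially"
    "uniform_limit (S \<times> S) (\<lambda>n z. bn n (snd z)) (\<lambda>z. b (snd z)) sequentially"
    by (rule uniform_limit_compose'[OF a(2)] uniform_limit_compose'[OF b(2)]; auto)+
  from uniform_lim_mult[OF this bdd]
  have lim: "uniform_limit (S \<times> S) ?wn ?w sequentially" .
  have e2: "0 < e / 2" using e by simp
  show "\<forall>\<^sub>F n in sequentially. \<forall>\<phi>. continuous_on (S \<times> S) \<phi> \<and> (\<forall>x\<in>S \<times> S. \<bar>\<phi> x\<bar> \<le> 1) \<longrightarrow>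
     \<bar>(\<integral>z. \<phi> z \<partial>(density (\<mu>\<^sub>1n n) (\<lambda>x. ennreal (an n x)) \<Otimes>\<^sub>M density (\<mu>\<^sub>2n n) (\<lambda>x. ennreal (bn n x))))
      - (\<integral>z. \<phi> z \<partial>(density \<mu>\<^sub>1 (\<lambda>x. ennreal (a x)) \<Otimes>\<^sub>M density \<mu>\<^sub>2 (\<lambda>x. ennreal (b x))))\<bar> \<le> e"
    using \<mu>n an bn norm_convD[OF conv e2 B(1)] uniform_limitD[OF lim e2]
  proof eventually_elim
    case (elim n)
    note \<mu>n = elim(1,2)
    note p1 = borel_probsD[OF \<mu>n(1)] and p2 = borel_probsD[OF \<mu>n(2)]
    interpret P: prob_space "\<mu>\<^sub>1n n \<Otimes>\<^sub>M \<mu>\<^sub>2n n" by (rule space_pair_borel_probs[OF \<mu>n])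
    note int = integrable_cont_pair[OF S prob_space.finite_measure[OF p1(1)] p1(2) prob_space.finite_measure[OF p2(1)] p2(2)]
    note wn = pos_cont_tensor[OF elim(3,4)]
    show ?case
    proof (intro allI impI)
      fix \<phi> :: "'a \<times> 'a \<Rightarrow> real"
      assume "continuous_on (S \<times> S) \<phi> \<and> (\<forall>z\<in>S \<times> S. \<bar>\<phi> z\<bar> \<le> 1)"
      then have \<phi>: "continuous_on (S \<times> S) \<phi>" "\<And>z. z \<in> S \<times> S \<Longrightarrow> \<bar>\<phi> z\<bar> \<le> 1" by auto
      have c: "continuous_on (S \<times> S) (\<lambda>z. ?wn n z * \<phi> z)" "continuous_on (S \<times> S) (\<lambda>z. ?w z * \<phi> z)"
        using wn w \<phi>(1) unfolding pos_cont_def by (auto intro: continuous_on_mult)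
      have "\<bar>?w z * \<phi> z\<bar> \<le> B" if "z \<in> S \<times> S" for z
      proof -
        have "0 < ?w z" using w that by (auto simp: pos_cont_def)
        then have "\<bar>?w z\<bar> \<le> B" using B(2)[OF that] by (simp only: abs_of_pos)
        then have "\<bar>?w z\<bar> * \<bar>\<phi> z\<bar> \<le> B * 1"
          using \<phi>(2)[OF that] B(1) by (intro mult_mono) simp_all
        then show ?thesis by (simp add: abs_mult)
      qed
      with c(2) elim(5) have 1: "\<bar>(\<integral>z. ?w z * \<phi> z \<partial>(\<mu>\<^sub>1n n \<Otimes>\<^sub>M \<mu>\<^sub>2n n)) - (\<integral>z. ?w z * \<phi> z \<partial>(\<mu>\<^sub>1 \<Otimes>\<^sub>M \<mu>\<^sub>2))\<bar> \<le> e / 2"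
        by blast
      have "\<bar>?wn n z * \<phi> z - ?w z * \<phi> z\<bar> \<le> e / 2" if "z \<in> S \<times> S" for z
      proof -
        have "\<bar>?wn n z - ?w z\<bar> * \<bar>\<phi> z\<bar> \<le> e / 2 * 1"
          using bspec[OF elim(6) that] \<phi>(2)[OF that] e by (intro mult_mono) (auto simp: dist_real_def)
        then show ?thesis by (simp add: abs_mult[symmetric] left_diff_distrib)
      qed
      then have "\<bar>\<integral>z. ?wn n z * \<phi> z - ?w z * \<phi> z \<partial>(\<mu>\<^sub>1n n \<Otimes>\<^sub>M \<mu>\<^sub>2n n)\<bar> \<le> (\<integral>z. e / 2 \<partial>(\<mu>\<^sub>1n n \<Otimes>\<^sub>M \<mu>\<^sub>2n n))"
        using int[OF c(1)] int[OF c(2)] space_pair_borel_probs(2)[OF \<mu>n]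
        by (intro order_trans[OF integral_abs_bound] integral_mono) auto
      then have 2: "\<bar>(\<integral>z. ?wn n z * \<phi> z \<partial>(\<mu>\<^sub>1n n \<Otimes>\<^sub>M \<mu>\<^sub>2n n)) - (\<integral>z. ?w z * \<phi> z \<partial>(\<mu>\<^sub>1n n \<Otimes>\<^sub>M \<mu>\<^sub>2n n))\<bar> \<le> e / 2"
        using int[OF c(1)] int[OF c(2)] by (simp add: P.prob_space)
      show "\<bar>(\<integral>z. \<phi> z \<partial>(density (\<mu>\<^sub>1n n) (\<lambda>x. ennreal (an n x)) \<Otimes>\<^sub>M density (\<mu>\<^sub>2n n) (\<lambda>x. ennreal (bn n x))))
          - (\<integral>z. \<phi> z \<partial>(density \<mu>\<^sub>1 (\<lambda>x. ennreal (a x)) \<Otimes>\<^sub>M density \<mu>\<^sub>2 (\<lambda>x. ennreal (b x))))\<bar> \<le> e"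
        unfolding integral_pair_density[OF S \<mu>n elim(3,4) \<phi>(1)] integral_pair_density[OF S \<mu> a(1) b(1) \<phi>(1)]
        using 1 2 by linarith
    qed
  qed
qed

lemma uniform_limit_ln:
  fixes f :: "'a::topological_space \<Rightarrow> real"
  assumes X: "compact X" "pos_cont X f" and lim: "uniform_limit X fn f F"
  shows "uniform_limit X (\<lambda>n x. ln (fn n x)) (\<lambda>x. ln (f x)) F"
proof -
  obtain m M where m: "0 < m" "\<forall>\<^sub>F n in F. \<forall>x\<in>X. m \<le> fn n x \<and> fn n x \<le> M"
    by (rule uniform_limit_pos_bounds[OF X lim]) blast
  have "continuous_on {m..M} ln" using m(1) by (intro continuous_intros) auto
  then have "uniformly_continuous_on {m..M} ln" by (intro compact_uniformly_continuous) auto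
  then show ?thesis
    by (rule uniform_limit_compose_uniformly_continuous_on[OF lim]) (use m(2) in auto)
qed

lemma tendsto_uniform_limit_moving:
  fixes f :: "'a::metric_space \<Rightarrow> real"
  assumes lim: "uniform_limit S fn f F" and f: "continuous_on S f" and x: "x \<in> S"
    and xn: "\<forall>\<^sub>F n in F. xn n \<in> S" "(xn \<longlongrightarrow> x) F"
  shows "((\<lambda>n. fn n (xn n)) \<longlongrightarrow> f x) F"
proof -
  have "((\<lambda>n. fn n (xn n) - f (xn n)) \<longlongrightarrow> 0) F"
  proof (rule tendstoI)
    fix e :: real assume "0 < e"
    from xn(1) uniform_limitD[OF lim this] show "\<forall>\<^sub>F n in F. dist (fn n (xn n) - f (xn n)) 0 < e"
      by eventually_elim (auto simp: dist_real_def)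
  qed
  from tendsto_add[OF this continuous_on_tendsto_compose[OF f xn(2) x xn(1)]] show ?thesis by simp
qed

section \<open>Convergence of the product measures and of the logarithms of the potentials\<close>

theorem theorem2p1:
  fixes S :: "'a::metric_space set"
    and q :: "'a \<times> 'a \<Rightarrow> real" and qn :: "nat \<Rightarrow> 'a \<times> 'a \<Rightarrow> real"
    and \<mu>\<^sub>1 \<mu>\<^sub>2 :: "'a measure" and \<mu>\<^sub>1n \<mu>\<^sub>2n :: "nat \<Rightarrow> 'a measure"
  assumes "compact S"
    and "continuous_on (S \<times> S) q" and "\<And>z. z \<in> S \<times> S \<Longrightarrow> q z > 0"
    and "\<And>n. n \<ge> 1 \<Longrightarrow> continuous_on (S \<times> S) (qn n)"
    and "\<And>n z. n \<ge> 1 \<Longrightarrow> z \<in> S \<times> S \<Longrightarrow> qn n z > 0"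
    and "\<mu>\<^sub>1 \<in> borel_probs S" and "\<mu>\<^sub>2 \<in> borel_probs S"
    and "\<And>n. n \<ge> 1 \<Longrightarrow> \<mu>\<^sub>1n n \<in> borel_probs S" and "\<And>n. n \<ge> 1 \<Longrightarrow> \<mu>\<^sub>2n n \<in> borel_probs S"
    and "(\<lambda>n. measure_diff_norm (S \<times> S) (\<mu>\<^sub>1n n \<Otimes>\<^sub>M \<mu>\<^sub>2n n) (\<mu>\<^sub>1 \<Otimes>\<^sub>M \<mu>\<^sub>2)
              + sup_norm_on (S \<times> S) (\<lambda>z. qn n z - q z)) \<longlonglongrightarrow> 0"
  shows "(\<lambda>n. measure_diff_norm (S \<times> S)
            (schroedinger_nu1 S (qn n) (\<mu>\<^sub>1n n) (\<mu>\<^sub>2n n) \<Otimes>\<^sub>M schroedinger_nu2 S (qn n) (\<mu>\<^sub>1n n) (\<mu>\<^sub>2n n))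
            (schroedinger_nu1 S q \<mu>\<^sub>1 \<mu>\<^sub>2 \<Otimes>\<^sub>M schroedinger_nu2 S q \<mu>\<^sub>1 \<mu>\<^sub>2)) \<longlonglongrightarrow> 0
    \<and> (\<lambda>n. sup_norm_on S (\<lambda>x. schroedinger_u1 S (qn n) (\<mu>\<^sub>1n n) (\<mu>\<^sub>2n n) x - schroedinger_u1 S q \<mu>\<^sub>1 \<mu>\<^sub>2 x)
          + sup_norm_on S (\<lambda>x. schroedinger_u2 S (qn n) (\<mu>\<^sub>1n n) (\<mu>\<^sub>2n n) x - schroedinger_u2 S q \<mu>\<^sub>1 \<mu>\<^sub>2 x)) \<longlonglongrightarrow> 0
    \<and> (\<forall>x xn. x \<in> S \<longrightarrow> (\<forall>n\<ge>1. xn n \<in> S) \<longrightarrow> xn \<longlonglongrightarrow> x \<longrightarrow>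
          (\<lambda>n. schroedinger_u1 S (qn n) (\<mu>\<^sub>1n n) (\<mu>\<^sub>2n n) (xn n)) \<longlonglongrightarrow> schroedinger_u1 S q \<mu>\<^sub>1 \<mu>\<^sub>2 x
        \<and> (\<lambda>n. schroedinger_u2 S (qn n) (\<mu>\<^sub>1n n) (\<mu>\<^sub>2n n) (xn n)) \<longlonglongrightarrow> schroedinger_u2 S q \<mu>\<^sub>1 \<mu>\<^sub>2 x)"
proof -
  note S = assms(1) and \<mu> = assms(6,7)
  have ne: "S \<noteq> {}" by (rule borel_probsD(4)[OF assms(6)])
  have S2: "compact (S \<times> S)" "S \<times> S \<noteq> {}" using S ne by (auto intro: compact_Times)
  have q: "pos_cont (S \<times> S) q" using assms(2,3) by (simp add: pos_cont_def)
  have qn1: "pos_cont (S \<times> S) (qn n)" if "1 \<le> n" for n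
    using assms(4,5) that by (simp add: pos_cont_def)
  \<comment> \<open>The hypotheses start at index 1, so properties of the sequences are carried in
    eventual form.\<close>
  have ev1: "\<forall>\<^sub>F n in sequentially. 1 \<le> n" by (rule eventually_ge_at_top)
  have qn: "\<forall>\<^sub>F n in sequentially. pos_cont (S \<times> S) (qn n)"
    and \<mu>n: "\<forall>\<^sub>F n in sequentially. \<mu>\<^sub>1n n \<in> borel_probs S" "\<forall>\<^sub>F n in sequentially. \<mu>\<^sub>2n n \<in> borel_probs S"
    using ev1 by (eventually_elim, use qn1 assms(8,9) in blast)+
  let ?D = "\<lambda>n. measure_diff_norm (S \<times> S) (\<mu>\<^sub>1n n \<Otimes>\<^sub>M \<mu>\<^sub>2n n) (\<mu>\<^sub>1 \<Otimes>\<^sub>M \<mu>\<^sub>2)"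
  let ?Q = "\<lambda>n. sup_norm_on (S \<times> S) (\<lambda>z. qn n z - q z)"
  note sp = space_pair_borel_probs[OF \<mu>]
  \<comment> \<open>Nonnegativity of both summands lets the vanishing of their sum pass to each of
    them.\<close>
  have D0: "\<forall>\<^sub>F n in sequentially. 0 \<le> ?D n"
    using \<mu>n by eventually_elim (intro measure_diff_norm_nonneg S2 sp space_pair_borel_probs)
  have Q0: "\<forall>\<^sub>F n in sequentially. 0 \<le> ?Q n"
    using qn
    by eventually_elim
      (intro sup_norm_on_nonneg S2 continuous_on_diff; use assms(2) in \<open>simp add: pos_cont_def\<close>)
  have D: "?D \<longlonglongrightarrow> 0"
  proof (rule tendsto_sandwich[OF D0 _ tendsto_const assms(10)])
    show "\<forall>\<^sub>F n in sequentially. ?D n \<le> ?D n + ?Q n" using Q0 by eventually_elim simp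
  qed
  have Q: "?Q \<longlonglongrightarrow> 0"
  proof (rule tendsto_sandwich[OF Q0 _ tendsto_const assms(10)])
    show "\<forall>\<^sub>F n in sequentially. ?Q n \<le> ?D n + ?Q n" using D0 by eventually_elim simp
  qed
  have qlim: "uniform_limit (S \<times> S) qn q sequentially"
  proof (rule sup_norm_on_imp_uniform_limit[OF S2 _ assms(2) Q])
    show "\<forall>\<^sub>F n in sequentially. continuous_on (S \<times> S) (qn n)"
      using qn by eventually_elim (simp add: pos_cont_def)
  qed
  have conv: "norm_conv (S \<times> S) (\<lambda>n. \<mu>\<^sub>1n n \<Otimes>\<^sub>M \<mu>\<^sub>2n n) (\<mu>\<^sub>1 \<Otimes>\<^sub>M \<mu>\<^sub>2)"
  proof (rule measure_diff_norm_imp_norm_conv[OF S2 _ sp D])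
    show "\<forall>\<^sub>F n in sequentially. prob_space (\<mu>\<^sub>1n n \<Otimes>\<^sub>M \<mu>\<^sub>2n n) \<and> space (\<mu>\<^sub>1n n \<Otimes>\<^sub>M \<mu>\<^sub>2n n) = S \<times> S"
      using \<mu>n by eventually_elim (intro conjI space_pair_borel_probs)
  qed
  note marg = norm_conv_marginals[OF S \<mu> \<mu>n conv]
  obtain f g where fg: "schroedinger_potentials S q \<mu>\<^sub>1 \<mu>\<^sub>2 f g"
    using ex_schroedinger_potentials[OF S \<mu> q] by blast
  \<comment> \<open>The guard inside the existential leaves the pair arbitrary at index 0, so that a
    choice over all \<open>n\<close> is possible.\<close>
  have "\<exists>p. 1 \<le> n \<longrightarrow> schroedinger_potentials S (qn n) (\<mu>\<^sub>1n n) (\<mu>\<^sub>2n n) (fst p) (snd p)" for n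
  proof (cases "1 \<le> n")
    case True
    then obtain f' g' where "schroedinger_potentials S (qn n) (\<mu>\<^sub>1n n) (\<mu>\<^sub>2n n) f' g'"
      using ex_schroedinger_potentials[OF S assms(8,9) qn1] by blast
    then show ?thesis by (intro exI[of _ "(f', g')"]) simp
  qed simp
  then have "\<exists>P. \<forall>n. 1 \<le> n \<longrightarrow> schroedinger_potentials S (qn n) (\<mu>\<^sub>1n n) (\<mu>\<^sub>2n n) (fst (P n)) (snd (P n))"
    by (intro choice) blast
  then obtain fn gn where fgn1: "\<And>n. 1 \<le> n \<Longrightarrow> schroedinger_potentials S (qn n) (\<mu>\<^sub>1n n) (\<mu>\<^sub>2n n) (fn n) (gn n)"
    by (elim exE) (rule that; blast)
  have fgn: "\<forall>\<^sub>F n in sequentially. schroedinger_potentials S (qn n) (\<mu>\<^sub>1n n) (\<mu>\<^sub>2n n) (fn n) (gn n)"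
    using ev1 by eventually_elim (rule fgn1)
  note lim = schroedinger_potentials_uniform_limit[OF S \<mu> q \<mu>n qn qlim marg fgn fg]
  have f: "pos_cont S f" and g: "pos_cont S g" using fg by (simp_all add: schroedinger_potentials_def)
  have fn: "\<forall>\<^sub>F n in sequentially. pos_cont S (fn n)" and gn: "\<forall>\<^sub>F n in sequentially. pos_cont S (gn n)"
    using fgn by (eventually_elim, simp add: schroedinger_potentials_def)+
  have inv: "\<forall>\<^sub>F n in sequentially. pos_cont S (\<lambda>x. 1 / h n x)"
      "uniform_limit S (\<lambda>n x. 1 / h n x) (\<lambda>x. 1 / l x) sequentially"
    if "\<forall>\<^sub>F n in sequentially. pos_cont S (h n)" "pos_cont S l" "uniform_limit S h l sequentially"
    for h :: "nat \<Rightarrow> 'a \<Rightarrow> real" and l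
  proof -
    show "\<forall>\<^sub>F n in sequentially. pos_cont S (\<lambda>x. 1 / h n x)"
      using that(1) by eventually_elim (rule pos_cont_inverse)
    show "uniform_limit S (\<lambda>n x. 1 / h n x) (\<lambda>x. 1 / l x) sequentially"
      using that by (intro uniform_limit_divide_pos_cont[OF S] uniform_limit_const) auto
  qed
  have "norm_conv (S \<times> S)
      (\<lambda>n. density (\<mu>\<^sub>1n n) (\<lambda>x. ennreal (1 / fn n x)) \<Otimes>\<^sub>M density (\<mu>\<^sub>2n n) (\<lambda>x. ennreal (1 / gn n x)))
      (density \<mu>\<^sub>1 (\<lambda>x. ennreal (1 / f x)) \<Otimes>\<^sub>M density \<mu>\<^sub>2 (\<lambda>x. ennreal (1 / g x)))"
    by (rule norm_conv_pair_density[OF S \<mu> \<mu>n conv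
          inv(1)[OF fn f lim(1)] pos_cont_inverse[OF f] inv(2)[OF fn f lim(1)]
          inv(1)[OF gn g lim(2)] pos_cont_inverse[OF g] inv(2)[OF gn g lim(2)]])
  from norm_conv_imp_measure_diff_norm[OF S2 this]
  have 1: "(\<lambda>n. measure_diff_norm (S \<times> S)
            (schroedinger_nu1 S (qn n) (\<mu>\<^sub>1n n) (\<mu>\<^sub>2n n) \<Otimes>\<^sub>M schroedinger_nu2 S (qn n) (\<mu>\<^sub>1n n) (\<mu>\<^sub>2n n))
            (schroedinger_nu1 S q \<mu>\<^sub>1 \<mu>\<^sub>2 \<Otimes>\<^sub>M schroedinger_nu2 S q \<mu>\<^sub>1 \<mu>\<^sub>2)) \<longlonglongrightarrow> 0"
  proof (rule Lim_transform_eventually)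
    show "\<forall>\<^sub>F n in sequentially. measure_diff_norm (S \<times> S)
        (density (\<mu>\<^sub>1n n) (\<lambda>x. ennreal (1 / fn n x)) \<Otimes>\<^sub>M density (\<mu>\<^sub>2n n) (\<lambda>x. ennreal (1 / gn n x)))
        (density \<mu>\<^sub>1 (\<lambda>x. ennreal (1 / f x)) \<Otimes>\<^sub>M density \<mu>\<^sub>2 (\<lambda>x. ennreal (1 / g x)))
      = measure_diff_norm (S \<times> S)
            (schroedinger_nu1 S (qn n) (\<mu>\<^sub>1n n) (\<mu>\<^sub>2n n) \<Otimes>\<^sub>M schroedinger_nu2 S (qn n) (\<mu>\<^sub>1n n) (\<mu>\<^sub>2n n))
            (schroedinger_nu1 S q \<mu>\<^sub>1 \<mu>\<^sub>2 \<Otimes>\<^sub>M schroedinger_nu2 S q \<mu>\<^sub>1 \<mu>\<^sub>2)"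
      using \<mu>n qn fgn
      by eventually_elim (simp only: schroedinger_pair_eq[OF S] schroedinger_pair_eq[OF S \<mu> q fg])
  qed
  let ?u1 = "\<lambda>n. schroedinger_u1 S (qn n) (\<mu>\<^sub>1n n) (\<mu>\<^sub>2n n)" and ?u2 = "\<lambda>n. schroedinger_u2 S (qn n) (\<mu>\<^sub>1n n) (\<mu>\<^sub>2n n)"
  let ?v1 = "schroedinger_u1 S q \<mu>\<^sub>1 \<mu>\<^sub>2" and ?v2 = "schroedinger_u2 S q \<mu>\<^sub>1 \<mu>\<^sub>2"
  note v = schroedinger_u_eq[OF S \<mu> q fg]
  have "\<forall>\<^sub>F n in sequentially. \<forall>x\<in>S. ln (fn n x) = ?u1 n x"
    using \<mu>n qn fgn by eventually_elim (simp add: schroedinger_u_eq[OF S])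
  from iffD1[OF uniform_limit_cong[OF this v(1)[symmetric]] uniform_limit_ln[OF S f lim(1)]]
  have u1: "uniform_limit S ?u1 ?v1 sequentially" .
  have "\<forall>\<^sub>F n in sequentially. \<forall>x\<in>S. ln (gn n x) = ?u2 n x"
    using \<mu>n qn fgn by eventually_elim (simp add: schroedinger_u_eq[OF S])
  from iffD1[OF uniform_limit_cong[OF this v(2)[symmetric]] uniform_limit_ln[OF S g lim(2)]]
  have u2: "uniform_limit S ?u2 ?v2 sequentially" .
  have 2: "(\<lambda>n. sup_norm_on S (\<lambda>x. ?u1 n x - ?v1 x) + sup_norm_on S (\<lambda>x. ?u2 n x - ?v2 x)) \<longlonglongrightarrow> 0"
    using tendsto_add[OF uniform_limit_imp_sup_norm_on[OF ne u1] uniform_limit_imp_sup_norm_on[OF ne u2]] by simp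
  have "continuous_on S (\<lambda>x. ln (f x))" "continuous_on S (\<lambda>x. ln (g x))"
    using f g by (auto simp: pos_cont_def intro!: continuous_on_ln)
  then have vc: "continuous_on S ?v1" "continuous_on S ?v2"
    using v by (simp_all cong: continuous_on_cong)
  have 3: "(\<lambda>n. ?u1 n (xn n)) \<longlonglongrightarrow> ?v1 x \<and> (\<lambda>n. ?u2 n (xn n)) \<longlonglongrightarrow> ?v2 x"
    if "x \<in> S" "\<forall>n\<ge>1. xn n \<in> S" "xn \<longlonglongrightarrow> x" for x xn
  proof -
    have "\<forall>\<^sub>F n in sequentially. xn n \<in> S" using ev1 by eventually_elim (use that(2) in blast)
    then show ?thesis
      using tendsto_uniform_limit_moving[OF u1 vc(1) that(1) _ that(3)]
        tendsto_uniform_limit_moving[OF u2 vc(2) that(1) _ that(3)] by blast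
  qed
  show ?thesis using 1 2 3 by blast
qed

end
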